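(* For any integer $m\geq 1$, let $$G_m=\left\langle a,t\ \middle|\ [t,\,a[a,t]^{-m}]\right\rangle$$ be the group with two generators $a,t$ and the single defining relator $[t,a[a,t]^{-m}]$. Then the following hold: (1) For every integer $m\ge 1$, the group $G_m$ contains the Baumslag–Solitar group $\mathrm{BS}(m,m+1)$ as a retract. (2) The group $G_2$ is not Hopfian, and hence it is not residually finite. (3) The group $G_1$ is not automatic.
   Context: Commutator convention: $[x,y]:=x^{-1}y^{-1}xy$. For nonzero integers $p,q$, the Baumslag–Solitar group is $\mathrm{BS}(p,q):=\langle c,t\mid t^{-1}c^pt=c^q\rangle$. A group $G$ contains a group $B$ as a retract if there are homomorphisms $\iota:B\to G$ and $\rho:G\to B$ with $\rho\circ\iota=\mathrm{id}_B$ (so $\iota$ is injective and $B$ is identified with the subgroup $\iota(B)$ of $G$). A group is Hopfian if every surjective endomorphism of it is injective. A group is residually finite if the intersection of all its normal subgroups of finite index is trivial. Automatic group: an automatic structure on a group $G$ consists of a finite set $A$ of semigroup generators of $G$ (i.e. a finite alphabet $A$ with a map to $G$ whose image generates $G$ as a semigroup; for a word $w$ over $A$, $\overline{w}$ denotes the element of $G$ it represents), a finite state automaton $W$ over $A$, and finite state automata $M_x$ over $(A,A)$ for $x\in A\cup\{\epsilon\}$, where $\epsilon$ is the null string, such that: (i) the map $L(W)\to G$, $w\mapsto\overline{w}$, is surjective, where $L(W)$ is the language recognized by $W$; (ii) for each $x\in A\cup\{\epsilon\}$, $(w_1,w_2)\in L(M_x)$ if and only if $w_1,w_2\in L(W)$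 and $\overline{w_1x}=\overline{w_2}$. Here an automaton over $(A,A)$ reads pairs of words $(w_1,w_2)$ over $A$ synchronously, letter by letter, the shorter word being padded at its end by an additional end-of-string symbol $\$\notin A$ so that both have equal length. A group is automatic if it admits an automatic structure. *)

theory Defs
  imports "HOL-Algebra.Coset"
begin

section \<open>Free groups and presentations\<close>

text \<open>
  A word over the generators is a list of letters; the letter \<open>(x, True)\<close> stands for \<open>x\<close>
  and \<open>(x, False)\<close> for the formal inverse of \<open>x\<close>. Two words are freely equivalent if they are
  related by inserting and deleting pairs of adjacent mutually inverse letters.
  The set of free generators is the whole type \<open>'x\<close>.
\<close>

type_synonym 'x word = "('x \<times> bool) list"

inductive free_eq :: "'x word \<Rightarrow> 'x word \<Rightarrow> bool" where
  free_refl: "free_eq u u"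
| free_sym: "free_eq u v \<Longrightarrow> free_eq v u"
| free_trans: "free_eq u v \<Longrightarrow> free_eq v w \<Longrightarrow> free_eq u w"
| free_cancel: "free_eq (u @ [(x, b), (x, \<not> b)] @ v) (u @ v)"

definition word_class :: "'x word \<Rightarrow> 'x word set" where
  "word_class u = {v. free_eq u v}"

definition free_group :: "'x word set monoid" where
  "free_group = \<lparr>carrier = range word_class,
                 mult = (\<lambda>P Q. \<Union>u\<in>P. \<Union>v\<in>Q. word_class (u @ v)),
                 one = word_class []\<rparr>"

definition free_gen :: "'x \<Rightarrow> 'x word set" where
  "free_gen x = word_class [(x, True)]"

definition normal_closure :: "('g, 'm) monoid_scheme \<Rightarrow> 'g set \<Rightarrow> 'g set" where
  "normal_closure G R = \<Inter> {N. N \<lhd> G \<and> R \<subseteq> N}"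

definition presented_group :: "'x word set set \<Rightarrow> 'x word set set monoid" where
  "presented_group R = free_group Mod (normal_closure free_group R)"

definition commutator :: "('g, 'm) monoid_scheme \<Rightarrow> 'g \<Rightarrow> 'g \<Rightarrow> 'g" where
  "commutator G x y = inv\<^bsub>G\<^esub> x \<otimes>\<^bsub>G\<^esub> inv\<^bsub>G\<^esub> y \<otimes>\<^bsub>G\<^esub> x \<otimes>\<^bsub>G\<^esub> y"

datatype bs_gen = BS_c | BS_t

text \<open>The relation \<open>t\<^sup>-\<^sup>1 c\<^sup>p t = c\<^sup>q\<close> is encoded by the relator \<open>t\<^sup>-\<^sup>1 c\<^sup>p t (c\<^sup>q)\<^sup>-\<^sup>1\<close>.\<close>

definition BS :: "int \<Rightarrow> int \<Rightarrow> bs_gen word set set monoid" where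
  "BS p q = presented_group
     (let F = free_group; c = free_gen BS_c; t = free_gen BS_t
      in {inv\<^bsub>F\<^esub> t \<otimes>\<^bsub>F\<^esub> (c [^]\<^bsub>F\<^esub> p) \<otimes>\<^bsub>F\<^esub> t \<otimes>\<^bsub>F\<^esub> inv\<^bsub>F\<^esub> (c [^]\<^bsub>F\<^esub> q)})"

datatype at_gen = Gen_a | Gen_t

definition Gm :: "int \<Rightarrow> at_gen word set set monoid" where
  "Gm m = presented_group
     (let F = free_group; a = free_gen Gen_a; t = free_gen Gen_t
      in {commutator F t (a \<otimes>\<^bsub>F\<^esub> (commutator F a t [^]\<^bsub>F\<^esub> (- m)))})"


section \<open>Retracts, Hopfian and residually finite groups\<close>

definition contains_as_retract ::
    "('g, 'm) monoid_scheme \<Rightarrow> ('b, 'n) monoid_scheme \<Rightarrow> bool" where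
  "contains_as_retract G B \<longleftrightarrow>
     (\<exists>\<iota>\<in>hom B G. \<exists>\<rho>\<in>hom G B. \<forall>b\<in>carrier B. \<rho> (\<iota> b) = b)"

definition hopfian :: "('g, 'm) monoid_scheme \<Rightarrow> bool" where
  "hopfian G \<longleftrightarrow> (\<forall>\<phi>\<in>epi G G. inj_on \<phi> (carrier G))"

definition residually_finite :: "('g, 'm) monoid_scheme \<Rightarrow> bool" where
  "residually_finite G \<longleftrightarrow> \<Inter> {N. N \<lhd> G \<and> finite (rcosets\<^bsub>G\<^esub> N)} = {\<one>\<^bsub>G\<^esub>}"


section \<open>Automatic groups\<close>

record ('q, 'a) dfa =
  dfa_states :: "'q set"
  dfa_init :: "'q"
  dfa_final :: "'q set"
  dfa_step :: "'q \<Rightarrow> 'a \<Rightarrow> 'q"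

definition is_dfa :: "'a set \<Rightarrow> ('q, 'a) dfa \<Rightarrow> bool" where
  "is_dfa A M \<longleftrightarrow> finite (dfa_states M) \<and> dfa_init M \<in> dfa_states M \<and>
     dfa_final M \<subseteq> dfa_states M \<and>
     (\<forall>q\<in>dfa_states M. \<forall>x\<in>A. dfa_step M q x \<in> dfa_states M)"

definition dfa_lang :: "'a set \<Rightarrow> ('q, 'a) dfa \<Rightarrow> 'a list set" where
  "dfa_lang A M = {w \<in> lists A. foldl (dfa_step M) (dfa_init M) w \<in> dfa_final M}"

text \<open>
  An automaton over \<open>(A, A)\<close> reads letters from \<open>pair_alphabet A\<close>, where \<open>None\<close> plays the role
  of the padding symbol \<open>$\<close>; the letter \<open>($, $)\<close> never occurs in a padded pair.
\<close>

definition pair_alphabet :: "'a set \<Rightarrow> ('a option \<times> 'a option) set" where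
  "pair_alphabet A =
     (insert None (Some ` A) \<times> insert None (Some ` A)) - {(None, None)}"

definition pad :: "nat \<Rightarrow> 'a list \<Rightarrow> 'a option list" where
  "pad n w = map Some w @ replicate (n - length w) None"

definition pad_pair :: "'a list \<Rightarrow> 'a list \<Rightarrow> ('a option \<times> 'a option) list" where
  "pad_pair w1 w2 =
     (let n = max (length w1) (length w2) in zip (pad n w1) (pad n w2))"

definition pair_lang ::
    "'a set \<Rightarrow> ('q, 'a option \<times> 'a option) dfa \<Rightarrow> ('a list \<times> 'a list) set" where
  "pair_lang A M = {(w1, w2). w1 \<in> lists A \<and> w2 \<in> lists A \<and>
     pad_pair w1 w2 \<in> dfa_lang (pair_alphabet A) M}"

definition word_val :: "('g, 'm) monoid_scheme \<Rightarrow> ('a \<Rightarrow> 'g) \<Rightarrow> 'a list \<Rightarrow> 'g" where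
  "word_val G \<mu> w = foldr (\<lambda>x g. \<mu> x \<otimes>\<^bsub>G\<^esub> g) w \<one>\<^bsub>G\<^esub>"

text \<open>
  The family \<open>M\<close> is indexed by \<open>A \<union> {\<epsilon>}\<close>, with \<open>None\<close> standing for the null string \<open>\<epsilon>\<close>.
  Semigroup generation uses nonempty words only.
\<close>

definition automatic_structure ::
    "('g, 'm) monoid_scheme \<Rightarrow> 'a set \<Rightarrow> ('a \<Rightarrow> 'g) \<Rightarrow> ('q, 'a) dfa \<Rightarrow>
     ('a option \<Rightarrow> ('r, 'a option \<times> 'a option) dfa) \<Rightarrow> bool" where
  "automatic_structure G A \<mu> W M \<longleftrightarrow>
     finite A \<and> \<mu> ` A \<subseteq> carrier G \<and>
     word_val G \<mu> ` (lists A - {[]}) = carrier G \<and>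
     is_dfa A W \<and>
     (\<forall>x\<in>insert None (Some ` A). is_dfa (pair_alphabet A) (M x)) \<and>
     word_val G \<mu> ` dfa_lang A W = carrier G \<and>
     (\<forall>x\<in>insert None (Some ` A). \<forall>w1\<in>lists A. \<forall>w2\<in>lists A.
        (w1, w2) \<in> pair_lang A (M x) \<longleftrightarrow>
          w1 \<in> dfa_lang A W \<and> w2 \<in> dfa_lang A W \<and>
          word_val G \<mu> (w1 @ (case x of None \<Rightarrow> [] | Some y \<Rightarrow> [y])) = word_val G \<mu> w2)"

text \<open>
  Alphabets and state sets are finite, so renaming their elements by natural numbers
  loses no generality.
\<close>

definition automatic :: "('g, 'm) monoid_scheme \<Rightarrow> bool" where
  "automatic G \<longleftrightarrow>
     (\<exists>(A :: nat set) \<mu> (W :: (nat, nat) dfa)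
        (M :: nat option \<Rightarrow> (nat, nat option \<times> nat option) dfa).
        automatic_structure G A \<mu> W M)"


section \<open>Basic properties of presented groups\<close>

lemma free_eq_append_left: "free_eq u v \<Longrightarrow> free_eq (w @ u) (w @ v)"
proof (induction rule: free_eq.induct)
  case (free_cancel u x b v)
  show ?case using free_eq.free_cancel[of "w @ u" x b v] by simp
qed (rule free_refl, erule free_sym, erule (1) free_trans)

lemma free_eq_append_right: "free_eq u v \<Longrightarrow> free_eq (u @ w) (v @ w)"
proof (induction rule: free_eq.induct)
  case (free_cancel u x b v)
  show ?case using free_eq.free_cancel[of u x b "v @ w"] by simp
qed (rule free_refl, erule free_sym, erule (1) free_trans)

lemma free_eq_append: "free_eq u v \<Longrightarrow> free_eq u' v' \<Longrightarrow> free_eq (u @ u') (v @ v')"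
  by (rule free_trans[OF free_eq_append_right free_eq_append_left])

lemma word_class_eq_iff: "word_class u = word_class v \<longleftrightarrow> free_eq u v"
proof
  assume "word_class u = word_class v"
  moreover have "v \<in> word_class v" by (simp add: word_class_def free_refl)
  ultimately show "free_eq u v" by (simp add: word_class_def set_eq_iff)
next
  assume "free_eq u v"
  then show "word_class u = word_class v"
    unfolding word_class_def by (blast intro: free_trans[of v u] free_trans[of u v] free_sym[of u v])
qed

lemma free_group_mult:
  "word_class u \<otimes>\<^bsub>free_group\<^esub> word_class v = word_class (u @ v)"
proof -
  have "word_class (u' @ v') = word_class (u @ v)"
    if "u' \<in> word_class u" "v' \<in> word_class v" for u' v'
    using that unfolding word_class_eq_iff
    by (intro free_sym[OF free_eq_append]) (simp_all add: word_class_def)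
  then have "(\<Union>u'\<in>word_class u. \<Union>v'\<in>word_class v. word_class (u' @ v'))
      = (\<Union>u'\<in>word_class u. \<Union>v'\<in>word_class v. word_class (u @ v))"
    by (intro SUP_cong refl) blast
  moreover have "u \<in> word_class u" "v \<in> word_class v"
    by (auto simp: word_class_def free_refl)
  ultimately show ?thesis by (auto simp: free_group_def)
qed

definition word_inv :: "'x word \<Rightarrow> 'x word" where
  "word_inv w = rev (map (\<lambda>(x, b). (x, \<not> b)) w)"

lemma free_eq_word_inv: "free_eq (word_inv w @ w) []"
proof (induction w)
  case Nil
  then show ?case by (simp add: word_inv_def free_refl)
next
  case (Cons l w)
  obtain x b where l: "l = (x, b)" by (cases l)
  have "free_eq (word_inv w @ [(x, \<not> b), (x, \<not> \<not> b)] @ w) (word_inv w @ w)"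
    by (rule free_cancel)
  then have "free_eq (word_inv (l # w) @ l # w) (word_inv w @ w)"
    by (simp add: word_inv_def l)
  then show ?case using Cons.IH by (rule free_trans)
qed

lemma group_free_group: "group (free_group :: 'x word set monoid)"
proof (rule groupI)
  show "x \<otimes>\<^bsub>free_group\<^esub> y \<in> carrier free_group"
    if "x \<in> carrier free_group" "y \<in> carrier free_group" for x y :: "'x word set"
  proof -
    obtain u v where "x = word_class u" "y = word_class v"
      using \<open>x \<in> _\<close> \<open>y \<in> _\<close> by (auto simp: free_group_def)
    then show ?thesis by (simp add: free_group_mult) (simp add: free_group_def)
  qed
  show "\<one>\<^bsub>free_group\<^esub> \<in> carrier (free_group :: 'x word set monoid)"
    by (simp add: free_group_def)
next
  fix x y z :: "'x word set"
  assume "x \<in> carrier free_group" "y \<in> carrier free_group" "z \<in> carrier free_group"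
  then obtain u v w where "x = word_class u" "y = word_class v" "z = word_class w"
    by (auto simp: free_group_def)
  then show "x \<otimes>\<^bsub>free_group\<^esub> y \<otimes>\<^bsub>free_group\<^esub> z = x \<otimes>\<^bsub>free_group\<^esub> (y \<otimes>\<^bsub>free_group\<^esub> z)"
    by (simp add: free_group_mult)
next
  fix x :: "'x word set"
  assume "x \<in> carrier free_group"
  then obtain u where u: "x = word_class u" by (auto simp: free_group_def)
  have one: "\<one>\<^bsub>free_group\<^esub> = word_class []" by (simp add: free_group_def)
  show "\<one>\<^bsub>free_group\<^esub> \<otimes>\<^bsub>free_group\<^esub> x = x"
    by (simp add: one u free_group_mult)
  show "\<exists>y\<in>carrier free_group. y \<otimes>\<^bsub>free_group\<^esub> x = \<one>\<^bsub>free_group\<^esub>"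
    by (rule bexI[of _ "word_class (word_inv u)"])
       (auto simp: one u free_group_mult word_class_eq_iff free_eq_word_inv, simp add: free_group_def)
qed

lemma (in group) normal_closure_normal:
  assumes "R \<subseteq> carrier G"
  shows "normal_closure G R \<lhd> G"
proof -
  have ne: "{N. N \<lhd> G \<and> R \<subseteq> N} \<noteq> {}"
    using assms normal_invI[OF subgroup_self] by auto
  have "subgroup (normal_closure G R) G"
    unfolding normal_closure_def
    by (rule subgroups_Inter) (use ne normal_imp_subgroup in auto)
  then show ?thesis
    by (rule normal_invI) (auto simp: normal_closure_def normal_inv_iff)
qed

lemma subset_normal_closure: "R \<subseteq> normal_closure G R"
  by (auto simp: normal_closure_def)

lemma group_presented_group:
  assumes "R \<subseteq> carrier free_group"
  shows "group (presented_group R)"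
  unfolding presented_group_def
  by (intro normal.factorgroup_is_group group.normal_closure_normal group_free_group assms)

lemma free_gen_closed: "free_gen x \<in> carrier free_group"
  by (simp add: free_gen_def free_group_def)

lemma commutator_closed:
  assumes "group G" "x \<in> carrier G" "y \<in> carrier G"
  shows "commutator G x y \<in> carrier G"
proof -
  interpret group G by fact
  show ?thesis using assms by (simp add: commutator_def)
qed

lemma group_BS: "group (BS p q)"
proof -
  interpret F: group "free_group :: bs_gen word set monoid" by (rule group_free_group)
  show ?thesis unfolding BS_def Let_def
    by (rule group_presented_group) (simp add: free_gen_closed)
qed

lemma group_Gm: "group (Gm m)"
proof -
  interpret F: group "free_group :: at_gen word set monoid" by (rule group_free_group)
  show ?thesis unfolding Gm_def Let_def
    by (rule group_presented_group)
       (simp add: free_gen_closed commutator_closed F.is_group)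
qed

text \<open>Universal properties of free groups and of presentations.\<close>

definition letter_val :: "('g, 'm) monoid_scheme \<Rightarrow> ('x \<Rightarrow> 'g) \<Rightarrow> 'x \<times> bool \<Rightarrow> 'g" where
  "letter_val G f l = (if snd l then f (fst l) else inv\<^bsub>G\<^esub> f (fst l))"

lemma (in group) word_val_closed:
  "\<mu> ` set w \<subseteq> carrier G \<Longrightarrow> word_val G \<mu> w \<in> carrier G"
  by (induction w) (auto simp: word_val_def)

lemma (in group) word_val_append:
  "\<mu> ` set u \<subseteq> carrier G \<Longrightarrow> \<mu> ` set v \<subseteq> carrier G \<Longrightarrow>
   word_val G \<mu> (u @ v) = word_val G \<mu> u \<otimes> word_val G \<mu> v"
proof (induction u)
  case Nil
  then show ?case using word_val_closed[of \<mu> v] by (simp add: word_val_def)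
next
  case (Cons l u)
  then show ?case using word_val_closed[of \<mu> u] word_val_closed[of \<mu> v]
    by (simp add: word_val_def m_assoc)
qed

lemma (in group) letter_val_closed: "range f \<subseteq> carrier G \<Longrightarrow> letter_val G f l \<in> carrier G"
  by (auto simp: letter_val_def image_subset_iff)

lemma (in group) word_val_free_eq:
  assumes "free_eq u v" "range f \<subseteq> carrier G"
  shows "word_val G (letter_val G f) u = word_val G (letter_val G f) v"
  using assms
proof (induction rule: free_eq.induct)
  case (free_cancel u x b v)
  then have f: "f x \<in> carrier G" by auto
  have cl: "letter_val G f ` S \<subseteq> carrier G" for S using free_cancel letter_val_closed by auto
  let ?v = "word_val G (letter_val G f)"
  have "?v [(x, b), (x, \<not> b)] = \<one>"
    using f by (cases b) (simp_all add: word_val_def letter_val_def)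
  moreover have "?v (u @ [(x, b), (x, \<not> b)] @ v) = ?v u \<otimes> (?v [(x, b), (x, \<not> b)] \<otimes> ?v v)"
    by (simp only: word_val_append cl)
  moreover have "?v u \<otimes> (\<one> \<otimes> ?v v) = ?v (u @ v)"
    by (simp add: word_val_append word_val_closed cl)
  ultimately show ?case by (simp only:)
next
  case (free_sym u v)
  show ?case by (rule free_sym.IH[OF free_sym.prems, symmetric])
next
  case (free_trans u v w)
  show ?case by (rule trans[OF free_trans.IH(1) free_trans.IH(2)]) (rule free_trans.prems)+
qed (rule refl)

lemma (in group) free_group_lift:
  fixes f :: "'x \<Rightarrow> 'a"
  assumes "range f \<subseteq> carrier G"
  obtains h where "h \<in> hom free_group G" "\<And>x. h (free_gen x) = f x"
    "\<And>w. h (word_class w) = word_val G (letter_val G f) w"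
proof -
  define h where "h P = word_val G (letter_val G f) (SOME w. w \<in> P)" for P
  have cl: "letter_val G f ` S \<subseteq> carrier G" for S using assms letter_val_closed by auto
  have h: "h (word_class w) = word_val G (letter_val G f) w" for w
  proof -
    have "(SOME v. v \<in> word_class w) \<in> word_class w"
      by (rule someI[of _ w]) (simp add: word_class_def free_refl)
    then have "free_eq w (SOME v. v \<in> word_class w)" by (simp add: word_class_def)
    from word_val_free_eq[OF this assms] show ?thesis by (simp only: h_def)
  qed
  have "h \<in> hom free_group G"
  proof (rule homI)
    fix x y :: "'x word set"
    assume "x \<in> carrier free_group"
    then obtain u where u: "x = word_class u" by (auto simp: free_group_def)
    show "h x \<in> carrier G" by (simp add: u h word_val_closed cl)
    assume "y \<in> carrier free_group"
    then obtain v where v: "y = word_class v" by (auto simp: free_group_def)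
    show "h (x \<otimes>\<^bsub>free_group\<^esub> y) = h x \<otimes> h y"
      by (simp add: u v h free_group_mult word_val_append cl)
  qed
  moreover have "h (free_gen x) = f x" for x
  proof -
    have "f x \<in> carrier G" using assms by auto
    then show ?thesis by (simp add: free_gen_def h word_val_def letter_val_def)
  qed
  ultimately show ?thesis using that h by blast
qed

definition presented_gen :: "'x word set set \<Rightarrow> 'x \<Rightarrow> 'x word set set" where
  "presented_gen R x = normal_closure free_group R #>\<^bsub>free_group\<^esub> free_gen x"

lemma (in group) presented_group_lift:
  fixes h :: "'x word set \<Rightarrow> 'a"
  assumes h: "h \<in> hom free_group G" and R: "R \<subseteq> carrier free_group"
    and rel: "\<And>r. r \<in> R \<Longrightarrow> h r = \<one>"
  obtains k where "k \<in> hom (presented_group R) G"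
    "\<And>x. k (presented_gen R x) = h (free_gen x)"
proof -
  interpret H: group_hom free_group G h
    by (intro group_hom.intro group_hom_axioms.intro group_free_group h is_group)
  have N: "normal_closure free_group R \<lhd> free_group"
    by (rule H.normal_closure_normal[OF R])
  have ker: "normal_closure free_group R \<subseteq> kernel free_group G h"
    unfolding normal_closure_def
    by (rule Inter_lower) (use H.normal_kernel R rel in \<open>auto simp: kernel_def\<close>)
  have cong: "h x = h y"
    if x: "x \<in> carrier free_group" and y: "y \<in> carrier free_group"
      and eq: "normal_closure free_group R #>\<^bsub>free_group\<^esub> x
             = normal_closure free_group R #>\<^bsub>free_group\<^esub> y" for x y
  proof -
    have "x \<in> normal_closure free_group R #>\<^bsub>free_group\<^esub> x"
      by (rule H.rcos_self[OF x normal_imp_subgroup[OF N]])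
    then have "x \<in> normal_closure free_group R #>\<^bsub>free_group\<^esub> y"
      unfolding eq .
    then obtain n where n: "n \<in> normal_closure free_group R" "x = n \<otimes>\<^bsub>free_group\<^esub> y"
      unfolding r_coset_def by blast
    with ker have "n \<in> carrier free_group" "h n = \<one>" unfolding kernel_def by blast+
    with n y show ?thesis by simp
  qed
  show ?thesis
  proof (rule FactGroup_universal[OF h N cong])
    fix k
    assume k: "k \<in> hom (free_group Mod normal_closure free_group R) G"
      "\<And>x. x \<in> carrier free_group \<Longrightarrow>
        k (normal_closure free_group R #>\<^bsub>free_group\<^esub> x) = h x"
    show ?thesis
    proof (rule that)
      show "k \<in> hom (presented_group R) G" using k(1) by (simp add: presented_group_def)
      show "k (presented_gen R x) = h (free_gen x)" for x
        unfolding presented_gen_def by (rule k(2)[OF free_gen_closed])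
    qed
  qed
qed

end

theory Submission
  imports Defs "HOL-Algebra.Multiplicative_Group" "HOL-Algebra.Bij" "HOL-Real_Asymp.Real_Asymp"
begin

text \<open>
  Put \<open>c = [a, t]\<close>. The relator of \<open>G\<^sub>m\<close> says that \<open>a c\<^sup>-\<^sup>m\<close> commutes with \<open>t\<close>, which is equivalent to
  \<open>t\<^sup>-\<^sup>1 c\<^sup>m t = c\<^sup>m\<^sup>+\<^sup>1\<close>; hence \<open>c, t\<close> span a copy of \<open>BS(m, m + 1)\<close>, onto which \<open>a \<mapsto> c\<^sup>m\<close>, \<open>t \<mapsto> t\<close> retracts.

  For \<open>m = 2\<close> the map \<open>a \<mapsto> a c\<^sup>2\<close>, \<open>t \<mapsto> t\<close> sends \<open>c\<close> to \<open>c\<^sup>2\<close>. It is onto, since \<open>c\<^sup>2\<close> and \<open>t\<close> generate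
  \<open>c\<^sup>3\<close> and thus \<open>c\<close>, and it kills \<open>[t\<^sup>-\<^sup>1 c t, c]\<close>, which is nontrivial but dies in every finite quotient.

  For \<open>m = 1\<close> the argument is that automatic groups have a quadratic Dehn function while \<open>BS(1, 2)\<close> does
  not. Instead of counting relators, the size of a loop is measured by summing along it edge weights
  that are additive up to a bounded error over bounded triangles. In an automatic group two paths that fellow
  travel have almost the same weight, so the weight of a loop is at most quadratic in its length,
  whereas \<open>BS(1, 2)\<close> has loops of length \<open>4 n + 4\<close> and weight more than \<open>2\<^sup>n\<close>.
\<close>

section \<open>Commutators and conjugation\<close>

lemma (in group) commutator_eq_iff:
  assumes "x \<in> carrier G" "y \<in> carrier G" "z \<in> carrier G"
  shows "commutator G x y = z \<longleftrightarrow> x \<otimes> y = y \<otimes> x \<otimes> z"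
proof -
  have "commutator G x y = inv (y \<otimes> x) \<otimes> (x \<otimes> y)"
    using assms by (simp add: commutator_def inv_mult_group m_assoc)
  then show ?thesis
    using assms by (simp add: inv_solve_left')
qed

lemma (in group) mult_inv_cancel_left [simp]:
  assumes "x \<in> carrier G" "y \<in> carrier G"
  shows "x \<otimes> (inv x \<otimes> y) = y" "inv x \<otimes> (x \<otimes> y) = y"
  using assms by (simp_all add: m_assoc[symmetric])

lemma (in group) commutator_eq_one_iff:
  assumes "x \<in> carrier G" "y \<in> carrier G"
  shows "commutator G x y = \<one> \<longleftrightarrow> x \<otimes> y = y \<otimes> x"
  using assms by (simp add: commutator_eq_iff)

lemma (in group_hom) hom_commutator:
  assumes "x \<in> carrier G" "y \<in> carrier G"
  shows "h (commutator G x y) = commutator H (h x) (h y)"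
  using assms by (simp add: commutator_def)

text \<open>Conjugation by \<open>t\<close> is an endomorphism, so one relation passes to all
  integer powers, negative ones included.\<close>

lemma (in group) int_pow_intertwine:
  assumes x: "x \<in> carrier G" and y: "y \<in> carrier G" and t: "t \<in> carrier G"
    and xy: "x \<otimes> t = t \<otimes> y"
  shows "x [^] (k::int) \<otimes> t = t \<otimes> y [^] k"
proof -
  let ?h = "\<lambda>z. inv t \<otimes> z \<otimes> t"
  have "?h \<in> hom G G"
  proof (rule homI)
    fix u v assume u: "u \<in> carrier G" and v: "v \<in> carrier G"
    have "v \<otimes> t = t \<otimes> (inv t \<otimes> v \<otimes> t)"
      using t v by (simp add: m_assoc)
    then show "?h (u \<otimes> v) = ?h u \<otimes> ?h v"
      using t u v by (simp add: m_assoc)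
  qed (use t in simp)
  then interpret h: group_hom G G ?h
    by (intro group_hom.intro group_hom_axioms.intro is_group)
  have "?h x = y" using x y t xy by (simp add: m_assoc inv_solve_left')
  then have "inv t \<otimes> (x [^] k \<otimes> t) = y [^] k"
    using h.hom_int_pow[OF x, of k] x y t by (simp add: m_assoc)
  then show ?thesis using x y t by (simp add: inv_solve_left')
qed

lemma (in group) pow_commute:
  assumes "x \<in> carrier G"
  shows "x [^] (i::int) \<otimes> x [^] (j::int) = x [^] j \<otimes> x [^] i"
  using assms by (simp add: int_pow_mult[symmetric] add.commute)

text \<open>The substitution \<open>b = a c\<^sup>-\<^sup>m\<close> turns the relation of \<open>G\<^sub>m\<close> into \<open>b t = t b\<close>
  together with the Baumslag-Solitar relation for \<open>c = [a, t]\<close> and \<open>t\<close>.\<close>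

lemma (in group) commutator_relation_iff:
  assumes a: "a \<in> carrier G" and t: "t \<in> carrier G" and c: "c \<in> carrier G"
    and act: "a \<otimes> t = t \<otimes> a \<otimes> c"
  shows "commutator G t (a \<otimes> c [^] (- m::int)) = \<one> \<longleftrightarrow> c [^] m \<otimes> t = t \<otimes> c [^] (m + 1)"
proof -
  define b where "b = a \<otimes> c [^] (- m)"
  have b: "b \<in> carrier G" using a c by (simp add: b_def)
  have ab: "a = b \<otimes> c [^] m"
    using a c by (simp add: b_def m_assoc int_pow_mult[symmetric])
  have "c [^] m \<otimes> c [^] (1::int) = c [^] (m + 1)" using c by (simp only: int_pow_mult)
  \<comment> \<open>With \<open>a = b c^m\<close>, the relation \<open>a t = t a c\<close> becomes
    \<open>b c^m t = t b c^(m + 1)\<close>; each direction below cancels one factor of it.\<close>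
  then have e: "b \<otimes> (c [^] m \<otimes> t) = (t \<otimes> b) \<otimes> c [^] (m + 1)"
    using act b c t by (simp add: ab m_assoc)
  show ?thesis unfolding b_def[symmetric] commutator_eq_one_iff[OF t b]
  proof
    assume "t \<otimes> b = b \<otimes> t"
    with e have "b \<otimes> (c [^] m \<otimes> t) = b \<otimes> (t \<otimes> c [^] (m + 1))"
      using b c t by (simp add: m_assoc)
    then show "c [^] m \<otimes> t = t \<otimes> c [^] (m + 1)" using b c t by simp
  next
    assume "c [^] m \<otimes> t = t \<otimes> c [^] (m + 1)"
    with e have "(b \<otimes> t) \<otimes> c [^] (m + 1) = (t \<otimes> b) \<otimes> c [^] (m + 1)"
      using b c t by (simp add: m_assoc)
    then show "t \<otimes> b = b \<otimes> t" using b c t by simp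
  qed
qed

section \<open>Generators and relators of presented groups\<close>

lemma presented_group_proj:
  assumes R: "R \<subseteq> carrier free_group"
  obtains p where "p \<in> hom free_group (presented_group R)"
    "p ` carrier free_group = carrier (presented_group R)"
    "\<And>x. p (free_gen x) = presented_gen R x" "\<And>r. r \<in> R \<Longrightarrow> p r = \<one>\<^bsub>presented_group R\<^esub>"
proof -
  interpret F: group free_group by (rule group_free_group)
  let ?N = "normal_closure free_group R"
  interpret N: normal ?N free_group by (rule F.normal_closure_normal[OF R])
  show ?thesis
  proof (rule that[of "\<lambda>x. ?N #>\<^bsub>free_group\<^esub> x"])
    show "(\<lambda>x. ?N #>\<^bsub>free_group\<^esub> x) \<in> hom free_group (presented_group R)"
      using N.r_coset_hom_Mod by (simp add: presented_group_def)
    show "(\<lambda>x. ?N #>\<^bsub>free_group\<^esub> x) ` carrier free_group = carrier (presented_group R)"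
      by (auto simp: presented_group_def FactGroup_def RCOSETS_def)
    show "?N #>\<^bsub>free_group\<^esub> free_gen x = presented_gen R x" for x
      by (simp add: presented_gen_def)
    show "?N #>\<^bsub>free_group\<^esub> r = \<one>\<^bsub>presented_group R\<^esub>" if "r \<in> R" for r
      using that subset_normal_closure[of R free_group]
      by (simp add: presented_group_def FactGroup_def N.rcos_const subsetD)
  qed
qed

lemma presented_gen_closed:
  "R \<subseteq> carrier free_group \<Longrightarrow> presented_gen R x \<in> carrier (presented_group R)"
  by (metis presented_group_proj free_gen_closed hom_in_carrier)

text \<open>Induction on representing words: a class is a product of letters, and the class of a
  formal inverse is the inverse of a generator.\<close>

lemma presented_group_generated:
  assumes R: "R \<subseteq> carrier free_group" and H: "subgroup H (presented_group R)"
    and gen: "\<And>x. presented_gen R x \<in> H"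
  shows "carrier (presented_group R) = H"
proof
  interpret P: group "presented_group R" by (rule group_presented_group[OF R])
  interpret H: subgroup H "presented_group R" by fact
  obtain p where p: "p \<in> hom free_group (presented_group R)"
    and im: "p ` carrier free_group = carrier (presented_group R)"
    and pg: "\<And>x. p (free_gen x) = presented_gen R x"
    using presented_group_proj[OF R] by metis
  interpret p: group_hom free_group "presented_group R" p
    by (intro group_hom.intro group_hom_axioms.intro group_free_group P.is_group p)
  have wc: "word_class w \<in> carrier free_group" for w :: "'a word"
    by (simp add: free_group_def)
  have one: "\<one>\<^bsub>free_group\<^esub> = word_class ([] :: 'a word)" by (simp add: free_group_def)
  have letter: "p (word_class [(x, b)]) \<in> H" for x b
  proof (cases b)
    case True
    then show ?thesis using gen pg by (simp add: free_gen_def)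
  next
    case False
    have "word_class [(x, False)] \<otimes>\<^bsub>free_group\<^esub> free_gen x = \<one>\<^bsub>free_group\<^esub>"
      using free_eq_word_inv[of "[(x, True)]"]
      by (simp add: free_gen_def free_group_mult one word_class_eq_iff word_inv_def)
    then have "word_class [(x, False)] = inv\<^bsub>free_group\<^esub> free_gen x"
      using p.inv_equality free_gen_closed wc by metis
    then show ?thesis using False gen pg p.hom_inv[OF free_gen_closed[of x]] by simp
  qed
  have "p (word_class w) \<in> H" for w
  proof (induction w)
    case Nil
    then show ?case using p.hom_one H.one_closed by (simp only: one)
  next
    case (Cons l w)
    obtain x b where l: "l = (x, b)" by (cases l)
    have "p (word_class (l # w)) = p (word_class [l]) \<otimes>\<^bsub>presented_group R\<^esub> p (word_class w)"
      using p.hom_mult[OF wc wc, of "[l]" w] by (simp add: free_group_mult)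
    then show ?case using Cons letter by (simp add: l)
  qed
  then show "carrier (presented_group R) \<subseteq> H"
    unfolding im[symmetric] by (auto simp: free_group_def)
  show "H \<subseteq> carrier (presented_group R)" by (rule H.subset)
qed

text \<open>The equalizer of two homomorphisms is a subgroup, and here it contains all
  generators.\<close>

lemma presented_group_hom_eq:
  assumes R: "R \<subseteq> carrier free_group" and G: "group G"
    and h: "h \<in> hom (presented_group R) G" and k: "k \<in> hom (presented_group R) G"
    and eq: "\<And>x. h (presented_gen R x) = k (presented_gen R x)"
    and z: "z \<in> carrier (presented_group R)"
  shows "h z = k z"
proof -
  interpret h: group_hom "presented_group R" G h
    by (intro group_hom.intro group_hom_axioms.intro group_presented_group R G h)
  interpret k: group_hom "presented_group R" G k
    by (intro group_hom.intro group_hom_axioms.intro group_presented_group R G k)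
  have "subgroup {z \<in> carrier (presented_group R). h z = k z} (presented_group R)"
    by (rule h.G.subgroupI) auto
  from presented_group_generated[OF R this] z eq presented_gen_closed[OF R] show ?thesis
    by blast
qed

section \<open>The groups \<open>G\<^sub>m\<close> and \<open>BS(p, q)\<close>\<close>

text \<open>Names the relator set written inline in \<open>Gm\<close>, so that lemmas on arbitrary
  presentations can be instantiated with it.\<close>

definition Gm_rel :: "int \<Rightarrow> at_gen word set set" where
  "Gm_rel m = (let F = free_group; a = free_gen Gen_a; t = free_gen Gen_t
      in {commutator F t (a \<otimes>\<^bsub>F\<^esub> (commutator F a t [^]\<^bsub>F\<^esub> (- m)))})"

definition BS_rel :: "int \<Rightarrow> int \<Rightarrow> bs_gen word set set" where
  "BS_rel p q = (let F = free_group; c = free_gen BS_c; t = free_gen BS_t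
      in {inv\<^bsub>F\<^esub> t \<otimes>\<^bsub>F\<^esub> (c [^]\<^bsub>F\<^esub> p) \<otimes>\<^bsub>F\<^esub> t \<otimes>\<^bsub>F\<^esub> inv\<^bsub>F\<^esub> (c [^]\<^bsub>F\<^esub> q)})"

lemma Gm_eq: "Gm m = presented_group (Gm_rel m)"
  by (simp add: Gm_def Gm_rel_def)

lemma BS_eq: "BS p q = presented_group (BS_rel p q)"
  by (simp add: BS_def BS_rel_def)

lemma Gm_rel_closed: "Gm_rel m \<subseteq> carrier free_group"
proof -
  interpret F: group "free_group :: at_gen word set monoid" by (rule group_free_group)
  show ?thesis by (simp add: Gm_rel_def Let_def free_gen_closed commutator_closed F.is_group)
qed

lemma BS_rel_closed: "BS_rel p q \<subseteq> carrier free_group"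
proof -
  interpret F: group "free_group :: bs_gen word set monoid" by (rule group_free_group)
  show ?thesis by (simp add: BS_rel_def Let_def free_gen_closed)
qed

abbreviation "Gm_a m \<equiv> presented_gen (Gm_rel m) Gen_a"
abbreviation "Gm_t m \<equiv> presented_gen (Gm_rel m) Gen_t"
abbreviation "Gm_c m \<equiv> commutator (Gm m) (Gm_a m) (Gm_t m)"
abbreviation "BS_gen_c p q \<equiv> presented_gen (BS_rel p q) BS_c"
abbreviation "BS_gen_t p q \<equiv> presented_gen (BS_rel p q) BS_t"

lemma Gm_gens_closed [simp]:
  "Gm_a m \<in> carrier (Gm m)" "Gm_t m \<in> carrier (Gm m)" "Gm_c m \<in> carrier (Gm m)"
  using presented_gen_closed[OF Gm_rel_closed, of m]
  by (simp_all add: Gm_eq[symmetric] commutator_closed group_Gm)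

lemma BS_gens_closed [simp]:
  "BS_gen_c p q \<in> carrier (BS p q)" "BS_gen_t p q \<in> carrier (BS p q)"
  using presented_gen_closed[OF BS_rel_closed, of p q] by (simp_all add: BS_eq[symmetric])

lemma Gm_generated:
  assumes "subgroup H (Gm m)" "Gm_a m \<in> H" "Gm_t m \<in> H"
  shows "carrier (Gm m) = H"
  unfolding Gm_eq
proof (rule presented_group_generated[OF Gm_rel_closed])
  show "subgroup H (presented_group (Gm_rel m))" using assms(1) unfolding Gm_eq .
  show "presented_gen (Gm_rel m) x \<in> H" for x using assms(2,3) by (cases x) simp_all
qed

lemma Gm_c: "Gm_a m \<otimes>\<^bsub>Gm m\<^esub> Gm_t m = Gm_t m \<otimes>\<^bsub>Gm m\<^esub> Gm_a m \<otimes>\<^bsub>Gm m\<^esub> Gm_c m"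
proof -
  interpret group "Gm m" by (rule group_Gm)
  show ?thesis using commutator_eq_iff[of "Gm_a m" "Gm_t m" "Gm_c m"] by simp
qed

text \<open>The relator dies in the quotient; \<open>commutator_relation_iff\<close> turns this into
  the Baumslag-Solitar relation.\<close>

lemma Gm_relation:
  "Gm_c m [^]\<^bsub>Gm m\<^esub> m \<otimes>\<^bsub>Gm m\<^esub> Gm_t m = Gm_t m \<otimes>\<^bsub>Gm m\<^esub> Gm_c m [^]\<^bsub>Gm m\<^esub> (m + 1)"
proof -
  interpret G: group "Gm m" by (rule group_Gm)
  obtain p where p: "p \<in> hom free_group (Gm m)"
    and pg: "\<And>x. p (free_gen x) = presented_gen (Gm_rel m) x"
    and pr: "\<And>r. r \<in> Gm_rel m \<Longrightarrow> p r = \<one>\<^bsub>Gm m\<^esub>"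
    using presented_group_proj[OF Gm_rel_closed, of m] unfolding Gm_eq by metis
  interpret p: group_hom free_group "Gm m" p
    by (intro group_hom.intro group_hom_axioms.intro group_free_group G.is_group p)
  have "commutator (Gm m) (Gm_t m) (Gm_a m \<otimes>\<^bsub>Gm m\<^esub> Gm_c m [^]\<^bsub>Gm m\<^esub> (- m)) = \<one>\<^bsub>Gm m\<^esub>"
    using pr[unfolded Gm_rel_def Let_def]
    by (simp add: p.hom_commutator p.hom_int_pow free_gen_closed commutator_closed group_free_group pg)
  with Gm_c show ?thesis by (subst (asm) G.commutator_relation_iff) auto
qed

lemma BS_relation:
  "BS_gen_c p q [^]\<^bsub>BS p q\<^esub> p \<otimes>\<^bsub>BS p q\<^esub> BS_gen_t p q
   = BS_gen_t p q \<otimes>\<^bsub>BS p q\<^esub> BS_gen_c p q [^]\<^bsub>BS p q\<^esub> q"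
proof -
  interpret G: group "BS p q" by (rule group_BS)
  obtain h where h: "h \<in> hom free_group (BS p q)"
    and hg: "\<And>x. h (free_gen x) = presented_gen (BS_rel p q) x"
    and hr: "\<And>r. r \<in> BS_rel p q \<Longrightarrow> h r = \<one>\<^bsub>BS p q\<^esub>"
    using presented_group_proj[OF BS_rel_closed, of p q] unfolding BS_eq by metis
  interpret h: group_hom free_group "BS p q" h
    by (intro group_hom.intro group_hom_axioms.intro group_free_group G.is_group h)
  let ?c = "BS_gen_c p q" and ?t = "BS_gen_t p q"
  have "inv\<^bsub>BS p q\<^esub> ?t \<otimes>\<^bsub>BS p q\<^esub> ?c [^]\<^bsub>BS p q\<^esub> p \<otimes>\<^bsub>BS p q\<^esub> ?t
      \<otimes>\<^bsub>BS p q\<^esub> inv\<^bsub>BS p q\<^esub> (?c [^]\<^bsub>BS p q\<^esub> q) = \<one>\<^bsub>BS p q\<^esub>"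
    using hr[unfolded BS_rel_def Let_def]
    by (simp add: h.hom_int_pow free_gen_closed hg)
  then have "inv\<^bsub>BS p q\<^esub> ?t \<otimes>\<^bsub>BS p q\<^esub> (?c [^]\<^bsub>BS p q\<^esub> p \<otimes>\<^bsub>BS p q\<^esub> ?t) = ?c [^]\<^bsub>BS p q\<^esub> q"
    by (subst (asm) G.inv_solve_right') (simp_all add: G.m_assoc)
  then show ?thesis by (simp add: G.inv_solve_left')
qed

text \<open>\<open>c\<close> is a separate parameter: \<open>act\<close> forces it to be the
  commutator of \<open>a\<close> and \<open>t\<close>, so applications only compare plain
  products.\<close>

lemma Gm_lift:
  assumes G: "group G" and a: "a \<in> carrier G" and t: "t \<in> carrier G" and c: "c \<in> carrier G"
    and act: "a \<otimes>\<^bsub>G\<^esub> t = t \<otimes>\<^bsub>G\<^esub> a \<otimes>\<^bsub>G\<^esub> c"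
    and rel: "c [^]\<^bsub>G\<^esub> m \<otimes>\<^bsub>G\<^esub> t = t \<otimes>\<^bsub>G\<^esub> c [^]\<^bsub>G\<^esub> (m + 1)"
  obtains h where "h \<in> hom (Gm m) G" "h (Gm_a m) = a" "h (Gm_t m) = t" "h (Gm_c m) = c"
proof -
  interpret group G by fact
  define f where "f x = (case x of Gen_a \<Rightarrow> a | Gen_t \<Rightarrow> t)" for x
  have "range f \<subseteq> carrier G" using a t by (auto simp: f_def split: at_gen.splits)
  then obtain h where h: "h \<in> hom free_group G" "\<And>x. h (free_gen x) = f x"
    using free_group_lift by metis
  interpret h: group_hom free_group G h
    by (intro group_hom.intro group_hom_axioms.intro group_free_group is_group h)
  have ac: "commutator G a t = c" using act a t c by (simp add: commutator_eq_iff)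
  have "h r = \<one>\<^bsub>G\<^esub>" if "r \<in> Gm_rel m" for r
    using that commutator_relation_iff[OF a t c act, of m] rel
    by (simp add: Gm_rel_def Let_def h.hom_commutator h.hom_int_pow free_gen_closed
        commutator_closed group_free_group h(2) f_def ac)
  then obtain k where k: "k \<in> hom (Gm m) G" "\<And>x. k (presented_gen (Gm_rel m) x) = f x"
    using presented_group_lift[OF h(1) Gm_rel_closed] h(2) unfolding Gm_eq by metis
  interpret k: group_hom "Gm m" G k
    by (intro group_hom.intro group_hom_axioms.intro group_Gm is_group k)
  show ?thesis
    by (rule that[OF k(1)]) (simp_all add: k.hom_commutator k(2) f_def ac)
qed

lemma BS_lift:
  assumes G: "group G" and c: "c \<in> carrier G" and t: "t \<in> carrier G"
    and rel: "c [^]\<^bsub>G\<^esub> p \<otimes>\<^bsub>G\<^esub> t = t \<otimes>\<^bsub>G\<^esub> c [^]\<^bsub>G\<^esub> q"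
  obtains h where "h \<in> hom (BS p q) G" "h (BS_gen_c p q) = c" "h (BS_gen_t p q) = t"
proof -
  interpret group G by fact
  define f where "f x = (case x of BS_c \<Rightarrow> c | BS_t \<Rightarrow> t)" for x
  have "range f \<subseteq> carrier G" using c t by (auto simp: f_def split: bs_gen.splits)
  then obtain h where h: "h \<in> hom free_group G" "\<And>x. h (free_gen x) = f x"
    using free_group_lift by metis
  interpret h: group_hom free_group G h
    by (intro group_hom.intro group_hom_axioms.intro group_free_group is_group h)
  have "inv\<^bsub>G\<^esub> t \<otimes>\<^bsub>G\<^esub> (c [^]\<^bsub>G\<^esub> p \<otimes>\<^bsub>G\<^esub> t) = c [^]\<^bsub>G\<^esub> q"
    using rel c t by (simp add: inv_solve_left')
  then have "h r = \<one>\<^bsub>G\<^esub>" if "r \<in> BS_rel p q" for r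
    using that c t
    by (simp add: BS_rel_def Let_def h.hom_int_pow free_gen_closed h(2) f_def m_assoc[symmetric] inv_solve_right' r_inv)
  then obtain k where k: "k \<in> hom (BS p q) G" "\<And>x. k (presented_gen (BS_rel p q) x) = f x"
    using presented_group_lift[OF h(1) BS_rel_closed] h(2) unfolding BS_eq by metis
  show ?thesis by (rule that[OF k(1)]) (simp_all add: k(2) f_def)
qed

text \<open>\<open>Gm_lift\<close> is applied with \<open>a\<close> sent to \<open>c^m\<close>.
  Since \<open>c^m t = t c^(m + 1) = t c^m c\<close>, the commutator of \<open>c^m\<close> and
  \<open>t\<close> is \<open>c\<close>.\<close>

lemma Gm_to_BS:
  obtains \<rho> where "\<rho> \<in> hom (Gm m) (BS m (m + 1))"
    "\<rho> (Gm_c m) = BS_gen_c m (m + 1)" "\<rho> (Gm_t m) = BS_gen_t m (m + 1)"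
proof -
  interpret B: group "BS m (m + 1)" by (rule group_BS)
  let ?c = "BS_gen_c m (m + 1)" and ?t = "BS_gen_t m (m + 1)"
  have "?c [^]\<^bsub>BS m (m + 1)\<^esub> (m + 1) = ?c [^]\<^bsub>BS m (m + 1)\<^esub> m \<otimes>\<^bsub>BS m (m + 1)\<^esub> ?c"
    using B.int_pow_mult[of ?c m 1] by simp
  then have "?c [^]\<^bsub>BS m (m + 1)\<^esub> m \<otimes>\<^bsub>BS m (m + 1)\<^esub> ?t
      = ?t \<otimes>\<^bsub>BS m (m + 1)\<^esub> ?c [^]\<^bsub>BS m (m + 1)\<^esub> m \<otimes>\<^bsub>BS m (m + 1)\<^esub> ?c"
    by (simp add: BS_relation B.m_assoc)
  note act = this
  show ?thesis
    by (rule Gm_lift[OF B.is_group _ _ _ act BS_relation]) (auto intro: that)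
qed

lemma BS_to_Gm:
  obtains \<iota> where "\<iota> \<in> hom (BS m (m + 1)) (Gm m)"
    "\<iota> (BS_gen_c m (m + 1)) = Gm_c m" "\<iota> (BS_gen_t m (m + 1)) = Gm_t m"
  by (rule BS_lift[OF group_Gm _ _ Gm_relation[of m]]) auto

theorem Gm_contains_BS_as_retract: "contains_as_retract (Gm m) (BS m (m + 1))"
proof -
  obtain \<rho> where r: "\<rho> \<in> hom (Gm m) (BS m (m + 1))"
    "\<rho> (Gm_c m) = BS_gen_c m (m + 1)" "\<rho> (Gm_t m) = BS_gen_t m (m + 1)"
    by (rule Gm_to_BS)
  obtain \<iota> where i: "\<iota> \<in> hom (BS m (m + 1)) (Gm m)"
    "\<iota> (BS_gen_c m (m + 1)) = Gm_c m" "\<iota> (BS_gen_t m (m + 1)) = Gm_t m"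
    by (rule BS_to_Gm)
  \<comment> \<open>Both maps fix the two generators, which determines them.\<close>
  have "(\<rho> \<circ> \<iota>) z = id z" if "z \<in> carrier (BS m (m + 1))" for z
  proof (rule presented_group_hom_eq[OF BS_rel_closed group_BS, where h = "\<rho> \<circ> \<iota>" and k = id])
    show "\<rho> \<circ> \<iota> \<in> hom (presented_group (BS_rel m (m + 1))) (BS m (m + 1))"
      using hom_compose[OF i(1) r(1)] by (simp add: BS_eq)
    show "id \<in> hom (presented_group (BS_rel m (m + 1))) (BS m (m + 1))"
      by (simp add: BS_eq hom_def)
    show "(\<rho> \<circ> \<iota>) (presented_gen (BS_rel m (m + 1)) x) = id (presented_gen (BS_rel m (m + 1)) x)" for x
      by (cases x) (simp_all add: r i)
    show "z \<in> carrier (presented_group (BS_rel m (m + 1)))" using that by (simp add: BS_eq)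
  qed
  with r(1) i(1) show ?thesis unfolding contains_as_retract_def by auto
qed

section \<open>\<open>G\<^sub>2\<close> is neither Hopfian nor residually finite\<close>

text \<open>This word vanishes whenever \<open>t^-1 c t\<close> is a power of \<open>c\<close>,
  which is how it dies in finite groups. With \<open>c^2\<close> in place of \<open>c\<close> the
  conjugate is \<open>c^3\<close>, which commutes with \<open>c^2\<close>.\<close>

definition conj_commutator :: "('g, 'm) monoid_scheme \<Rightarrow> 'g \<Rightarrow> 'g \<Rightarrow> 'g" where
  "conj_commutator G c t = commutator G (inv\<^bsub>G\<^esub> t \<otimes>\<^bsub>G\<^esub> c \<otimes>\<^bsub>G\<^esub> t) c"

lemma (in group_hom) hom_conj_commutator:
  assumes "c \<in> carrier G" "t \<in> carrier G"
  shows "h (conj_commutator G c t) = conj_commutator H (h c) (h t)"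
  using assms by (simp add: conj_commutator_def hom_commutator)

lemma (in group) conj_commutator_eq_one_iff:
  assumes "c \<in> carrier G" "t \<in> carrier G"
  shows "conj_commutator G c t = \<one> \<longleftrightarrow> inv t \<otimes> c \<otimes> t \<otimes> c = c \<otimes> (inv t \<otimes> c \<otimes> t)"
  using assms by (simp add: conj_commutator_def commutator_eq_one_iff)

text \<open>In a model of \<open>BS(2, 3)\<close> on \<open>\<int> \<times> \<int>\<close> the generator \<open>c\<close> shifts the first coordinate. It has
  infinitely many orbits, so \<open>c\<^sup>2\<close> and \<open>c\<^sup>3\<close> are conjugate in the symmetric group; \<open>t\<close> maps
  the orbits of \<open>c\<^sup>3\<close> bijectively to those of \<open>c\<^sup>2\<close>.\<close>

definition shift :: "int \<times> int \<Rightarrow> int \<times> int" where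
  "shift = (\<lambda>(n, y). (n + 1, y))"

definition regroup :: "int \<times> int \<Rightarrow> int \<times> int" where
  "regroup = (\<lambda>(n, y). (2 * (n div 3) + (3 * y + n mod 3) mod 2, (3 * y + n mod 3) div 2))"

lemma bij_shift: "bij shift"
  by (rule o_bij[of "\<lambda>(n, y). (n - 1, y)"]) (auto simp: shift_def fun_eq_iff)

lemma bij_regroup: "bij regroup"
proof (rule o_bij)
  \<comment> \<open>The orbit of \<open>(n, y)\<close> under the cube of \<open>shift\<close> is
    labelled by \<open>3 * y + n mod 3\<close>, with position \<open>n div 3\<close> in it; for the
    square the label of \<open>(u, v)\<close> is \<open>2 * v + u mod 2\<close> and the position
    \<open>u div 2\<close>. \<open>regroup\<close> preserves label and position, and
    \<open>?g\<close> does the same backwards.\<close>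
  let ?g = "\<lambda>(u :: int, v :: int). (3 * (u div 2) + (2 * v + u mod 2) mod 3, (2 * v + u mod 2) div 3)"
  have two: "(2 * q + s mod 2) div 2 = q" "(2 * q + s mod 2) mod 2 = s mod 2" for q s :: int
    by presburger+
  have three: "(3 * q + s mod 3) div 3 = q" "(3 * q + s mod 3) mod 3 = s mod 3" for q s :: int
    by presburger+
  show "?g \<circ> regroup = id"
    by (simp add: regroup_def fun_eq_iff two three)
  show "regroup \<circ> ?g = id"
    by (simp add: regroup_def fun_eq_iff two three)
qed

lemma regroup_shift: "shift (shift (regroup z)) = regroup (shift (shift (shift z)))"
proof -
  obtain n y where z: "z = (n, y)" by (cases z)
  have "(n + 3) div 3 = n div 3 + 1" "(n + 3) mod 3 = n mod 3" by simp_all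
  then show ?thesis by (simp add: z shift_def regroup_def add.assoc)
qed

lemma BijGroup_UNIV:
  "carrier (BijGroup UNIV) = {f. bij f}" "\<one>\<^bsub>BijGroup UNIV\<^esub> = id"
  "bij f \<Longrightarrow> bij g \<Longrightarrow> f \<otimes>\<^bsub>BijGroup UNIV\<^esub> g = f \<circ> g"
  by (auto simp: BijGroup_def Bij_def compose_def fun_eq_iff)

lemma conj_commutator_BS_2_3: "conj_commutator (BS 2 3) (BS_gen_c 2 3) (BS_gen_t 2 3) \<noteq> \<one>\<^bsub>BS 2 3\<^esub>"
proof
  let ?P = "BijGroup (UNIV :: (int \<times> int) set)"
  let ?X = "inv\<^bsub>?P\<^esub> regroup \<otimes>\<^bsub>?P\<^esub> shift \<otimes>\<^bsub>?P\<^esub> regroup"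
  interpret P: group ?P by (rule group_BijGroup)
  have [simp]: "shift \<in> carrier ?P" "regroup \<in> carrier ?P"
    by (simp_all add: BijGroup_UNIV bij_shift bij_regroup)
  have pow: "shift [^]\<^bsub>?P\<^esub> (2::int) = shift \<circ> shift"
    "shift [^]\<^bsub>?P\<^esub> (3::int) = shift \<circ> shift \<circ> shift"
    using P.int_pow_mult[of shift 1 1] P.int_pow_mult[of shift 2 1]
    by (simp_all add: BijGroup_UNIV bij_shift bij_comp)
  have rel: "shift [^]\<^bsub>?P\<^esub> (2::int) \<otimes>\<^bsub>?P\<^esub> regroup = regroup \<otimes>\<^bsub>?P\<^esub> shift [^]\<^bsub>?P\<^esub> (3::int)"
    unfolding pow by (simp add: BijGroup_UNIV bij_shift bij_regroup bij_comp fun_eq_iff regroup_shift)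
  obtain h where h: "h \<in> hom (BS 2 3) ?P" "h (BS_gen_c 2 3) = shift" "h (BS_gen_t 2 3) = regroup"
    by (rule BS_lift[OF P.is_group _ _ rel]) auto
  interpret h: group_hom "BS 2 3" ?P h
    by (intro group_hom.intro group_hom_axioms.intro group_BS P.is_group h)
  assume "conj_commutator (BS 2 3) (BS_gen_c 2 3) (BS_gen_t 2 3) = \<one>\<^bsub>BS 2 3\<^esub>"
  then have "h (conj_commutator (BS 2 3) (BS_gen_c 2 3) (BS_gen_t 2 3)) = \<one>\<^bsub>?P\<^esub>"
    by (simp only: h.hom_one)
  then have "conj_commutator ?P shift regroup = \<one>\<^bsub>?P\<^esub>"
    by (simp add: h.hom_conj_commutator h)
  then have comm: "?X \<otimes>\<^bsub>?P\<^esub> shift = shift \<otimes>\<^bsub>?P\<^esub> ?X"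
    by (simp add: P.conj_commutator_eq_one_iff)
  \<comment> \<open>\<open>X\<close> is the conjugate \<open>t^-1 c t\<close>, characterized by an
    equation in which the inverse of \<open>regroup\<close> does not occur.\<close>
  obtain X where X: "X \<in> carrier ?P" "regroup \<otimes>\<^bsub>?P\<^esub> X = shift \<otimes>\<^bsub>?P\<^esub> regroup"
      "X \<otimes>\<^bsub>?P\<^esub> shift = shift \<otimes>\<^bsub>?P\<^esub> X"
  proof (rule that)
    show "?X \<in> carrier ?P" by simp
    show "regroup \<otimes>\<^bsub>?P\<^esub> ?X = shift \<otimes>\<^bsub>?P\<^esub> regroup" by (simp add: P.m_assoc)
  qed (rule comm)
  have "bij X" using X(1) by (simp only: BijGroup_UNIV mem_Collect_eq)
  then have "regroup \<circ> X = shift \<circ> regroup" "X \<circ> shift = shift \<circ> X"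
    using X(2,3) by (simp_all only: BijGroup_UNIV(3) bij_shift bij_regroup)
  then have step: "regroup (X z) = shift (regroup z)" and cm: "X (shift z) = shift (X z)" for z
    by (metis comp_apply)+
  have inj: "inj regroup" using bij_regroup by (rule bij_is_inj)
  \<comment> \<open>Evaluation near the origin: commuting would make \<open>X (1, 0)\<close> equal
    to \<open>shift (X (0, 0))\<close>, but these are \<open>(3, 0)\<close> and
    \<open>(2, 0)\<close>.\<close>
  have "regroup (X (0, 0)) = regroup (1, 0)"
    unfolding step by (simp add: shift_def regroup_def)
  with inj have X0: "X (0, 0) = (1, 0)" by (rule injD)
  have "regroup (X (1, 0)) = regroup (3, 0)"
    unfolding step by (simp add: shift_def regroup_def)
  with inj have X1: "X (1, 0) = (3, 0)" by (rule injD)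
  show False using cm[of "(0, 0)"] by (simp add: shift_def X0 X1)
qed

text \<open>Nontriviality is detected in BS(2, 3), through the retraction.\<close>

lemma conj_commutator_Gm_2: "conj_commutator (Gm 2) (Gm_c 2) (Gm_t 2) \<noteq> \<one>\<^bsub>Gm 2\<^esub>"
proof
  obtain \<rho> where r: "\<rho> \<in> hom (Gm 2) (BS 2 3)" "\<rho> (Gm_c 2) = BS_gen_c 2 3" "\<rho> (Gm_t 2) = BS_gen_t 2 3"
    using Gm_to_BS[of 2] by auto
  interpret r: group_hom "Gm 2" "BS 2 3" \<rho>
    by (intro group_hom.intro group_hom_axioms.intro group_Gm group_BS r)
  assume "conj_commutator (Gm 2) (Gm_c 2) (Gm_t 2) = \<one>\<^bsub>Gm 2\<^esub>"
  then have "\<rho> (conj_commutator (Gm 2) (Gm_c 2) (Gm_t 2)) = \<one>\<^bsub>BS 2 3\<^esub>" by (simp only: r.hom_one)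
  then show False using conj_commutator_BS_2_3 by (simp add: r.hom_conj_commutator r)
qed

theorem Gm_2_not_hopfian: "\<not> hopfian (Gm 2)"
proof
  let ?G = "Gm 2" and ?a = "Gm_a 2" and ?c = "Gm_c 2" and ?t = "Gm_t 2"
  interpret group ?G by (rule group_Gm)
  let ?c2 = "?c [^]\<^bsub>?G\<^esub> (2::int)" and ?c3 = "?c [^]\<^bsub>?G\<^esub> (3::int)"
  have rel: "?c2 \<otimes>\<^bsub>?G\<^esub> ?t = ?t \<otimes>\<^bsub>?G\<^esub> ?c3" using Gm_relation[of 2] by simp
  have cc: "?c \<otimes>\<^bsub>?G\<^esub> ?c3 = ?c2 \<otimes>\<^bsub>?G\<^esub> ?c2"
    using int_pow_mult[of ?c 1 3] int_pow_mult[of ?c 2 2] by simp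
  \<comment> \<open>Moving \<open>t\<close> to the left past \<open>a c^2\<close> leaves
    \<open>c c^3 = c^2 c^2\<close> behind, so the commutator of \<open>a c^2\<close> and
    \<open>t\<close> is \<open>c^2\<close>.\<close>
  have "?a \<otimes>\<^bsub>?G\<^esub> ?c2 \<otimes>\<^bsub>?G\<^esub> ?t = (?a \<otimes>\<^bsub>?G\<^esub> ?t) \<otimes>\<^bsub>?G\<^esub> ?c3"
    by (simp add: m_assoc rel)
  also have "\<dots> = ?t \<otimes>\<^bsub>?G\<^esub> ?a \<otimes>\<^bsub>?G\<^esub> (?c \<otimes>\<^bsub>?G\<^esub> ?c3)"
    by (subst Gm_c) (simp add: m_assoc)
  also have "\<dots> = ?t \<otimes>\<^bsub>?G\<^esub> (?a \<otimes>\<^bsub>?G\<^esub> ?c2) \<otimes>\<^bsub>?G\<^esub> ?c2"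
    unfolding cc by (simp add: m_assoc)
  finally have act: "?a \<otimes>\<^bsub>?G\<^esub> ?c2 \<otimes>\<^bsub>?G\<^esub> ?t = ?t \<otimes>\<^bsub>?G\<^esub> (?a \<otimes>\<^bsub>?G\<^esub> ?c2) \<otimes>\<^bsub>?G\<^esub> ?c2" .
  \<comment> \<open>The relation for \<open>c^2\<close> is the square of the relation for
    \<open>c\<close>.\<close>
  have rel2: "?c2 [^]\<^bsub>?G\<^esub> (2::int) \<otimes>\<^bsub>?G\<^esub> ?t = ?t \<otimes>\<^bsub>?G\<^esub> ?c2 [^]\<^bsub>?G\<^esub> (2 + 1 :: int)"
    using int_pow_intertwine[OF _ _ _ rel, of 2] by (simp add: int_pow_pow)
  obtain \<phi> where p: "\<phi> \<in> hom ?G ?G" "\<phi> ?a = ?a \<otimes>\<^bsub>?G\<^esub> ?c2" "\<phi> ?t = ?t" "\<phi> ?c = ?c2"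
    by (rule Gm_lift[OF is_group _ _ _ act rel2]) auto
  interpret p: group_hom ?G ?G \<phi>
    by (intro group_hom.intro group_hom_axioms.intro is_group p)
  let ?H = "\<phi> ` carrier ?G"
  interpret H: subgroup ?H ?G by (rule p.img_is_subgroup)
  have "\<phi> ?t \<in> ?H" "\<phi> ?c \<in> ?H" "\<phi> ?a \<in> ?H" by (intro imageI Gm_gens_closed)+
  then have tH: "?t \<in> ?H" and c2H: "?c2 \<in> ?H" and a2H: "?a \<otimes>\<^bsub>?G\<^esub> ?c2 \<in> ?H"
    unfolding p(2-4) .
  \<comment> \<open>The image contains \<open>a c^2\<close> and \<open>c^2\<close>, hence
    \<open>a\<close>; together with \<open>t\<close> this generates the group.\<close>
  have "?a \<otimes>\<^bsub>?G\<^esub> ?c2 \<otimes>\<^bsub>?G\<^esub> inv\<^bsub>?G\<^esub> ?c2 = ?a" by (simp add: m_assoc)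
  then have aH: "?a \<in> ?H" using H.m_closed[OF a2H H.m_inv_closed[OF c2H]] by (simp only:)
  have "?H = carrier ?G" by (rule Gm_generated[OF H.subgroup_axioms aH tH, symmetric])
  with p(1) have epi: "\<phi> \<in> epi ?G ?G" by (simp only: epi_def mem_Collect_eq)
  have "\<phi> (conj_commutator ?G ?c ?t) = conj_commutator ?G ?c2 ?t" by (simp add: p.hom_conj_commutator p)
  also have "\<dots> = \<one>\<^bsub>?G\<^esub>"
  proof -
    have "inv\<^bsub>?G\<^esub> ?t \<otimes>\<^bsub>?G\<^esub> ?c2 \<otimes>\<^bsub>?G\<^esub> ?t = ?c3" by (simp add: m_assoc rel)
    then show ?thesis using pow_commute[of ?c 3 2] by (simp add: conj_commutator_eq_one_iff)
  qed
  finally have eq: "\<phi> (conj_commutator ?G ?c ?t) = \<phi> \<one>\<^bsub>?G\<^esub>" by simp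
  assume "hopfian ?G"
  with epi have "inj_on \<phi> (carrier ?G)" by (simp only: hopfian_def)
  from inj_onD[OF this eq] have "conj_commutator ?G ?c ?t = \<one>\<^bsub>?G\<^esub>"
    by (simp add: conj_commutator_def commutator_closed group_Gm)
  with conj_commutator_Gm_2 show False ..
qed

text \<open>In a finite group the relation forces \<open>c\<close> to have odd order, so that \<open>c\<close> is a power of \<open>c\<^sup>2\<close> and
  its conjugate by \<open>t\<close> is a power of \<open>c\<^sup>3\<close>.\<close>

lemma (in group) conj_commutator_eq_one_of_finite:
  assumes fin: "finite (carrier G)" and c: "c \<in> carrier G" and t: "t \<in> carrier G"
    and rel: "c [^] (2::int) \<otimes> t = t \<otimes> c [^] (3::int)"
  shows "conj_commutator G c t = \<one>"
proof -
  define k where "k = int (ord c)"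
  have "k > 0" using ord_ge_1[OF fin c] by (simp add: k_def)
  have k1: "c [^] k = \<one>" using c by (simp add: k_def int_pow_int)
  have conj: "(c [^] (2::int)) [^] j \<otimes> t = t \<otimes> (c [^] (3::int)) [^] j" for j :: int
    by (rule int_pow_intertwine) (use c t rel in auto)
  \<comment> \<open>If the order were \<open>2 l\<close>, the \<open>l\<close>-th power of the
    relation would give \<open>c^(3 l) = 1\<close>, so \<open>2 l\<close> would divide
    \<open>3 l\<close>.\<close>
  have "odd k"
  proof
    assume "even k"
    then obtain l where l: "k = 2 * l" by blast
    have "(c [^] (2::int)) [^] l = \<one>" using c k1 by (simp add: int_pow_pow l)
    then have "t \<otimes> (c [^] (3::int)) [^] l = t \<otimes> \<one>" using conj[of l] t by simp
    then have "(c [^] (3::int)) [^] l = \<one>" using c t by (subst (asm) Units_l_cancel) auto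
    then have "c [^] (3 * l) = \<one>" using c by (simp add: int_pow_pow)
    then have "k dvd 3 * l" using c by (simp add: int_pow_eq_id k_def)
    then have "2 * l dvd 2 * l + l" by (simp add: l)
    then have "2 * l dvd l" by (simp add: dvd_add_right_iff)
    then show False using \<open>k > 0\<close> l zdvd_imp_le[of "2 * l" l] by linarith
  qed
  then obtain l where l: "k = 2 * l + 1" by (rule oddE)
  have "(c [^] (2::int)) [^] (l + 1) = c [^] (k + 1)" using c by (simp add: int_pow_pow l algebra_simps)
  also have "\<dots> = c" using c k1 int_pow_mult[of c k 1] by simp
  finally have "inv t \<otimes> c \<otimes> t = (c [^] (3::int)) [^] (l + 1)"
    using conj[of "l + 1"] c t by (simp add: m_assoc)
  then show ?thesis
    using c t pow_commute[of c "3 * (l + 1)" 1] by (simp add: conj_commutator_eq_one_iff int_pow_pow)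
qed

theorem Gm_2_not_residually_finite: "\<not> residually_finite (Gm 2)"
proof
  let ?G = "Gm 2" and ?c = "Gm_c 2" and ?t = "Gm_t 2"
  interpret group ?G by (rule group_Gm)
  let ?w = "conj_commutator ?G ?c ?t"
  have w: "?w \<in> carrier ?G" by (simp add: conj_commutator_def commutator_closed group_Gm)
  \<comment> \<open>A finite quotient inherits the relation, so the word becomes trivial
    there.\<close>
  have "?w \<in> N" if N: "N \<lhd> ?G" and fin: "finite (rcosets\<^bsub>?G\<^esub> N)" for N
  proof -
    interpret N: normal N ?G by fact
    interpret Q: group "?G Mod N" by (rule N.factorgroup_is_group)
    let ?q = "\<lambda>x. N #>\<^bsub>?G\<^esub> x"
    interpret q: group_hom ?G "?G Mod N" ?q
      by (intro group_hom.intro group_hom_axioms.intro is_group Q.is_group N.r_coset_hom_Mod)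
    have "?q (?c [^]\<^bsub>?G\<^esub> (2::int) \<otimes>\<^bsub>?G\<^esub> ?t) = ?q (?t \<otimes>\<^bsub>?G\<^esub> ?c [^]\<^bsub>?G\<^esub> (3::int))"
      using Gm_relation[of 2] by simp
    then have "?q ?c [^]\<^bsub>?G Mod N\<^esub> (2::int) \<otimes>\<^bsub>?G Mod N\<^esub> ?q ?t
        = ?q ?t \<otimes>\<^bsub>?G Mod N\<^esub> ?q ?c [^]\<^bsub>?G Mod N\<^esub> (3::int)"
      by (simp only: q.hom_mult q.hom_int_pow Gm_gens_closed int_pow_closed)
    then have "conj_commutator (?G Mod N) (?q ?c) (?q ?t) = \<one>\<^bsub>?G Mod N\<^esub>"
      by (intro Q.conj_commutator_eq_one_of_finite)
         (use fin in \<open>auto simp: FactGroup_def intro!: q.hom_closed[unfolded FactGroup_def, simplified]\<close>)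
    then have "?q ?w = N" using q.hom_conj_commutator[of ?c ?t] by (simp add: FactGroup_def)
    then show ?thesis using rcos_self[OF w N.subgroup_axioms] by simp
  qed
  moreover assume "residually_finite ?G"
  ultimately have "?w \<in> {\<one>\<^bsub>?G\<^esub>}" unfolding residually_finite_def by blast
  with conj_commutator_Gm_2 show False by simp
qed

section \<open>Weighted loops in automatic groups\<close>

lemma pad_pair_simps [simp]:
  "pad_pair [] [] = []"
  "pad_pair (x # u) (y # v) = (Some x, Some y) # pad_pair u v"
  "pad_pair [] (y # v) = (None, Some y) # pad_pair [] v"
  "pad_pair (x # u) [] = (Some x, None) # pad_pair u []"
  by (simp_all add: pad_pair_def pad_def Let_def)

text \<open>Padding occurs only at the end, so a word that is already padded in the first block must
  contribute nothing to the second.\<close>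

lemma pad_pair_append:
  assumes "length u1 = length u2 \<or> length u1 < length u2 \<and> v1 = [] \<or> length u2 < length u1 \<and> v2 = []"
  shows "pad_pair (u1 @ v1) (u2 @ v2) = pad_pair u1 u2 @ pad_pair v1 v2"
  using assms
proof (induction u1 arbitrary: u2)
  case Nil
  then show ?case by (induction u2) auto
next
  case (Cons x u1)
  show ?case
  proof (cases u2)
    case Nil
    then have "v2 = []" using Cons.prems by simp
    moreover have "pad_pair (u @ v1) [] = pad_pair u [] @ pad_pair v1 []" for u
      by (induction u) auto
    ultimately show ?thesis using Nil by simp
  next
    case (Cons y u2')
    then show ?thesis using Cons.IH[of u2'] Cons.prems by auto
  qed
qed

lemma pad_pair_in_lists:
  "u \<in> lists A \<Longrightarrow> v \<in> lists A \<Longrightarrow> pad_pair u v \<in> lists (pair_alphabet A)"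
proof (induction u arbitrary: v)
  case Nil
  then show ?case by (induction v) (auto simp: pair_alphabet_def)
next
  case (Cons x u)
  then show ?case
  proof (cases v)
    case Nil
    have "pad_pair u [] \<in> lists (pair_alphabet A)" using Cons.IH[of "[]"] Cons.prems by simp
    then show ?thesis using Nil Cons.prems by (auto simp: pair_alphabet_def)
  next
    case (Cons y v')
    then show ?thesis using Cons.IH[of v'] Cons.prems by (auto simp: pair_alphabet_def)
  qed
qed

lemma is_dfa_foldl:
  "is_dfa A M \<Longrightarrow> q \<in> dfa_states M \<Longrightarrow> w \<in> lists A \<Longrightarrow> foldl (dfa_step M) q w \<in> dfa_states M"
  by (induction w arbitrary: q) (auto simp: is_dfa_def)

text \<open>The tail of an accepted pair after reading \<open>i\<close> letters can be replaced by one depending only on the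
  state reached and on which of the two words has already ended.\<close>

lemma pair_lang_completion:
  assumes M: "is_dfa (pair_alphabet A) M"
  obtains C where "finite C" "C \<subseteq> lists A \<times> lists A"
    "\<And>w1 w2 i. (w1, w2) \<in> pair_lang A M \<Longrightarrow>
       \<exists>(v1, v2) \<in> C. (take i w1 @ v1, take i w2 @ v2) \<in> pair_lang A M \<and> (length w1 < i \<longrightarrow> v1 = [])"
proof -
  \<comment> \<open>A key is a state with two flags telling which words have ended; \<open>T\<close>
    collects the tails accepted from there. There are finitely many keys, and one pair of tails is
    chosen for each usable one.\<close>
  define T where "T = (\<lambda>(q, b1, b2). {(v1, v2). v1 \<in> lists A \<and> v2 \<in> lists A \<and> (b1 \<longrightarrow> v1 = [])
      \<and> (b2 \<longrightarrow> v2 = []) \<and> foldl (dfa_step M) q (pad_pair v1 v2) \<in> dfa_final M})"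
  define keys where "keys = {k \<in> dfa_states M \<times> UNIV \<times> UNIV. T k \<noteq> {}}"
  define f where "f k = (SOME v. v \<in> T k)" for k
  have f: "f k \<in> T k" if "k \<in> keys" for k
    using that by (auto simp: keys_def f_def intro: someI)
  show ?thesis
  proof (rule that[of "f ` keys"])
    have "finite (dfa_states M)" using M by (simp add: is_dfa_def)
    then show "finite (f ` keys)" by (simp add: keys_def)
    show "f ` keys \<subseteq> lists A \<times> lists A" using f by (fastforce simp: T_def)
    fix w1 w2 i
    assume w: "(w1, w2) \<in> pair_lang A M"
    then have wA: "w1 \<in> lists A" "w2 \<in> lists A" by (auto simp: pair_lang_def)
    then have tA: "take i w1 \<in> lists A" "take i w2 \<in> lists A" "drop i w1 \<in> lists A" "drop i w2 \<in> lists A"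
      by (auto dest: in_set_takeD in_set_dropD)
    define q where "q = foldl (dfa_step M) (dfa_init M) (pad_pair (take i w1) (take i w2))"
    \<comment> \<open>The flags are strict: a word of length exactly \<open>i\<close> has received
      no padding yet and may still be extended.\<close>
    define k where "k = (q, length w1 < i, length w2 < i)"
    have split: "pad_pair (take i w1 @ v1) (take i w2 @ v2) = pad_pair (take i w1) (take i w2) @ pad_pair v1 v2"
      if "length w1 < i \<longrightarrow> v1 = []" "length w2 < i \<longrightarrow> v2 = []" for v1 v2
      by (rule pad_pair_append) (use that in auto)
    have "foldl (dfa_step M) (dfa_init M) (pad_pair w1 w2) \<in> dfa_final M"
      using w by (simp add: pair_lang_def dfa_lang_def)
    then have "(drop i w1, drop i w2) \<in> T k"
      using split[of "drop i w1" "drop i w2"] tA by (simp add: T_def k_def q_def)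
    moreover have "q \<in> dfa_states M"
      unfolding q_def
      by (rule is_dfa_foldl[OF M _ pad_pair_in_lists[OF tA(1,2)]]) (use M in \<open>simp add: is_dfa_def\<close>)
    ultimately have "k \<in> keys" by (auto simp: keys_def k_def)
    moreover obtain v1 v2 where v: "f k = (v1, v2)" by (cases "f k")
    ultimately have vT: "(v1, v2) \<in> T k" using f by metis
    then have "(take i w1 @ v1, take i w2 @ v2) \<in> pair_lang A M"
      using split[of v1 v2] tA pad_pair_in_lists[of "take i w1 @ v1" A "take i w2 @ v2"]
      by (simp add: T_def k_def q_def pair_lang_def dfa_lang_def)
    moreover have "length w1 < i \<longrightarrow> v1 = []" using vT by (simp add: T_def k_def)
    ultimately show "\<exists>(v1, v2) \<in> f ` keys. (take i w1 @ v1, take i w2 @ v2) \<in> pair_lang A M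
        \<and> (length w1 < i \<longrightarrow> v1 = [])"
      using \<open>k \<in> keys\<close> v by (metis (mono_tags, lifting) case_prodI image_eqI)
  qed
qed

section \<open>Path sums, edge weights and their behaviour along accepted words\<close>

fun path_sum :: "('g, 'm) monoid_scheme \<Rightarrow> ('g \<Rightarrow> 'g \<Rightarrow> real) \<Rightarrow> 'g \<Rightarrow> 'g list \<Rightarrow> real" where
  "path_sum G F g [] = 0"
| "path_sum G F g (x # xs) = F g x + path_sum G F (g \<otimes>\<^bsub>G\<^esub> x) xs"

lemma word_val_simps [simp]:
  "word_val G \<mu> [] = \<one>\<^bsub>G\<^esub>" "word_val G \<mu> (x # w) = \<mu> x \<otimes>\<^bsub>G\<^esub> word_val G \<mu> w"
  by (simp_all add: word_val_def)

lemma (in group) path_sum_append: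
  assumes "g \<in> carrier G" "set xs \<subseteq> carrier G"
  shows "path_sum G F g (xs @ ys) = path_sum G F g xs + path_sum G F (g \<otimes> word_val G id xs) ys"
  using assms
proof (induction xs arbitrary: g)
  case (Cons x xs)
  have "word_val G id xs \<in> carrier G" using Cons.prems by (intro word_val_closed) auto
  then have e: "g \<otimes> x \<otimes> word_val G id xs = g \<otimes> word_val G id (x # xs)"
    using Cons.prems by (simp add: m_assoc)
  have "path_sum G F (g \<otimes> x) (xs @ ys)
      = path_sum G F (g \<otimes> x) xs + path_sum G F (g \<otimes> x \<otimes> word_val G id xs) ys"
    by (rule Cons.IH) (use Cons.prems in auto)
  then show ?case by (simp only: append_Cons path_sum.simps e add.assoc)
qed simp

text \<open>\<open>F g s\<close> is the weight of the edge from \<open>g\<close> to \<open>g s\<close>; over bounded triangles the weights are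
  additive up to a bounded error.\<close>

locale edge_weight = group G for G (structure) +
  fixes F :: "'a \<Rightarrow> 'a \<Rightarrow> real"
  assumes F_one: "g \<in> carrier G \<Longrightarrow> F g \<one> = 0"
    and defect: "finite S \<Longrightarrow> S \<subseteq> carrier G \<Longrightarrow>
      \<exists>B. \<forall>g\<in>carrier G. \<forall>s\<in>S. \<forall>s'\<in>S. \<bar>F g s + F (g \<otimes> s) s' - F g (s \<otimes> s')\<bar> \<le> B"

locale automatic_edge_weight = edge_weight G F for G (structure) and F +
  fixes A :: "'letter set" and \<mu> and W :: "('q, 'letter) dfa"
    and M :: "'letter option \<Rightarrow> ('r, 'letter option \<times> 'letter option) dfa"
  assumes auto: "automatic_structure G A \<mu> W M"
begin

abbreviation "val \<equiv> word_val G \<mu>"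
abbreviation "L \<equiv> dfa_lang A W"
abbreviation "wt w \<equiv> path_sum G F \<one> (map \<mu> w)"
definition "ext x = (case x of None \<Rightarrow> \<one> | Some y \<Rightarrow> \<mu> y)"

lemma finA: "finite A"
  and mu: "\<mu> ` A \<subseteq> carrier G"
  and gen: "val ` (lists A - {[]}) = carrier G"
  and onto: "val ` L = carrier G"
  and dfa: "x \<in> insert None (Some ` A) \<Longrightarrow> is_dfa (pair_alphabet A) (M x)"
  using auto by (auto simp: automatic_structure_def)

lemma muD: "x \<in> A \<Longrightarrow> \<mu> x \<in> carrier G" using mu by auto

lemma L_lists: "w \<in> L \<Longrightarrow> w \<in> lists A" by (simp add: dfa_lang_def)

lemma val_closed: "w \<in> lists A \<Longrightarrow> val w \<in> carrier G"
  using mu by (intro word_val_closed) auto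

lemma val_append: "u \<in> lists A \<Longrightarrow> v \<in> lists A \<Longrightarrow> val (u @ v) = val u \<otimes> val v"
  using mu by (intro word_val_append) auto

lemma ext_closed: "x \<in> insert None (Some ` A) \<Longrightarrow> ext x \<in> carrier G"
  by (auto simp: ext_def muD)

lemma pair_lang_iff:
  assumes "x \<in> insert None (Some ` A)"
  shows "(w1, w2) \<in> pair_lang A (M x) \<longleftrightarrow> w1 \<in> L \<and> w2 \<in> L \<and> val w1 \<otimes> ext x = val w2"
proof (cases "w1 \<in> lists A \<and> w2 \<in> lists A")
  case True
  have "val (w1 @ (case x of None \<Rightarrow> [] | Some y \<Rightarrow> [y])) = val w1 \<otimes> ext x"
  proof (cases x)
    case None
    then show ?thesis using val_closed[of w1] True by (simp add: ext_def)
  next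
    case (Some y)
    then have "y \<in> A" using assms by auto
    then show ?thesis using Some val_append[of w1 "[y]"] muD True by (simp add: ext_def)
  qed
  moreover have "\<forall>w1\<in>lists A. \<forall>w2\<in>lists A. (w1, w2) \<in> pair_lang A (M x) \<longleftrightarrow>
      w1 \<in> L \<and> w2 \<in> L \<and> val (w1 @ (case x of None \<Rightarrow> [] | Some y \<Rightarrow> [y])) = val w2"
    using auto assms unfolding automatic_structure_def by blast
  ultimately show ?thesis using True by simp
next
  case False
  then show ?thesis by (auto simp: pair_lang_def dfa_lang_def)
qed

lemma word_val_map: "word_val G id (map \<mu> w) = val w"
  by (induction w) simp_all

lemma wt_snoc:
  assumes "u \<in> lists A" "a \<in> A"
  shows "wt (u @ [a]) = wt u + F (val u) (\<mu> a)"
  using assms muD val_closed by (subst map_append, subst path_sum_append) (auto simp: word_val_map)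

text \<open>Past the end of the word the step is the identity, which has weight 0. Words of
  different lengths can thus be followed with a common index.\<close>

lemma prefix_step:
  assumes "w \<in> lists A"
  obtains s where "s \<in> insert \<one> (\<mu> ` A)" "val (take (Suc i) w) = val (take i w) \<otimes> s"
    "wt (take (Suc i) w) = wt (take i w) + F (val (take i w)) s"
proof (cases "i < length w")
  case True
  have t: "take i w \<in> lists A" using assms by (auto dest: in_set_takeD)
  have a: "w ! i \<in> A" using assms True by auto
  show ?thesis
  proof (rule that[of "\<mu> (w ! i)"])
    show "val (take (Suc i) w) = val (take i w) \<otimes> \<mu> (w ! i)"
      using val_append[OF t, of "[w ! i]"] a muD[OF a] True by (simp add: take_Suc_conv_app_nth)
    show "wt (take (Suc i) w) = wt (take i w) + F (val (take i w)) (\<mu> (w ! i))"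
      using wt_snoc[OF t a] True by (simp only: take_Suc_conv_app_nth)
  qed (use a in simp)
next
  case False
  then show ?thesis using assms val_closed by (intro that[of \<one>]) (auto simp: F_one)
qed

text \<open>Completing both prefixes by tails from a finite set yields an accepted pair, so the
  difference of the prefixes is determined by the tails.\<close>

lemma fellow_travel:
  assumes x: "x \<in> insert None (Some ` A)"
  obtains D where "finite D" "D \<subseteq> carrier G"
    "\<And>w1 w2 i. (w1, w2) \<in> pair_lang A (M x) \<Longrightarrow> inv (val (take i w1)) \<otimes> val (take i w2) \<in> D"
proof -
  obtain C where C: "finite C" "C \<subseteq> lists A \<times> lists A"
    and complete: "\<And>w1 w2 i. (w1, w2) \<in> pair_lang A (M x) \<Longrightarrow>
       \<exists>(v1, v2) \<in> C. (take i w1 @ v1, take i w2 @ v2) \<in> pair_lang A (M x) \<and> (length w1 < i \<longrightarrow> v1 = [])"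
    by (rule pair_lang_completion[OF dfa[OF x]], rule that)
  let ?d = "\<lambda>(v1, v2). val v1 \<otimes> ext x \<otimes> inv (val v2)"
  show ?thesis
  proof (rule that[of "?d ` C"])
    show "finite (?d ` C)" using C by simp
    show "?d ` C \<subseteq> carrier G"
    proof (rule image_subsetI)
      fix v assume "v \<in> C"
      moreover obtain v1 v2 where v: "v = (v1, v2)" by (cases v)
      ultimately have "v1 \<in> lists A" "v2 \<in> lists A" using C(2) by blast+
      then show "?d v \<in> carrier G" using val_closed[of v1] val_closed[of v2] ext_closed[OF x] by (simp add: v)
    qed
    fix w1 w2 i assume w: "(w1, w2) \<in> pair_lang A (M x)"
    obtain v1 v2 where v: "(v1, v2) \<in> C" and p: "(take i w1 @ v1, take i w2 @ v2) \<in> pair_lang A (M x)"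
      using complete[OF w, of i] by auto
    have tA: "take i w1 \<in> lists A" "take i w2 \<in> lists A" and vA: "v1 \<in> lists A" "v2 \<in> lists A"
      using p by (auto simp: pair_lang_def)
    define g where "g = val (take i w1)"
    define h where "h = val (take i w2)"
    have cl: "g \<in> carrier G" "h \<in> carrier G" "val v1 \<in> carrier G" "val v2 \<in> carrier G" "ext x \<in> carrier G"
      using tA vA val_closed ext_closed[OF x] by (auto simp: g_def h_def)
    have "g \<otimes> val v1 \<otimes> ext x = h \<otimes> val v2"
      using p tA vA by (simp add: pair_lang_iff[OF x] val_append g_def h_def)
    then have "g \<otimes> (val v1 \<otimes> ext x \<otimes> inv (val v2)) = h"
      using cl by (simp add: m_assoc[symmetric] inv_solve_right')
    then have "inv g \<otimes> h = val v1 \<otimes> ext x \<otimes> inv (val v2)"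
      using cl by (simp add: inv_solve_left')
    then show "inv (val (take i w1)) \<otimes> val (take i w2) \<in> ?d ` C"
      using v by (auto simp: g_def h_def intro!: rev_image_eqI)
  qed
qed

text \<open>The strip between the two paths is cut into squares by the differences
  \<open>d i\<close>. Each square consists of two triangles of defect at most \<open>B\<close>, so
  the discrepancy grows by at most \<open>2 * B\<close> per letter.\<close>

lemma strip:
  assumes x: "x \<in> insert None (Some ` A)"
  obtains K where "K \<ge> 0" "\<And>w1 w2. (w1, w2) \<in> pair_lang A (M x) \<Longrightarrow>
    \<bar>wt w1 + F (val w1) (ext x) - wt w2\<bar> \<le> K * (real (length w1) + real (length w2))"
proof -
  obtain D where D: "finite D" "D \<subseteq> carrier G"
    and ft: "\<And>w1 w2 i. (w1, w2) \<in> pair_lang A (M x) \<Longrightarrow> inv (val (take i w1)) \<otimes> val (take i w2) \<in> D"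
    by (rule fellow_travel[OF x], rule that)
  let ?S = "D \<union> insert \<one> (\<mu> ` A)"
  have S: "?S \<subseteq> carrier G" using D mu by auto
  have "finite ?S" using D finA by auto
  then obtain B where B: "\<And>g s s'. g \<in> carrier G \<Longrightarrow> s \<in> ?S \<Longrightarrow> s' \<in> ?S \<Longrightarrow>
      \<bar>F g s + F (g \<otimes> s) s' - F g (s \<otimes> s')\<bar> \<le> B"
    using defect[OF _ S] by blast
  have "\<bar>F \<one> \<one> + F (\<one> \<otimes> \<one>) \<one> - F \<one> (\<one> \<otimes> \<one>)\<bar> \<le> B" by (rule B) auto
  then have B0: "B \<ge> 0" by linarith
  show ?thesis
  proof (rule that[of "2 * B"])
    show "2 * B \<ge> 0" using B0 by simp
    fix w1 w2 assume w: "(w1, w2) \<in> pair_lang A (M x)"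
    then have wA: "w1 \<in> lists A" "w2 \<in> lists A" by (auto simp: pair_lang_def)
    then have tA: "take i w1 \<in> lists A" "take i w2 \<in> lists A" for i
      by (auto dest: in_set_takeD)
    define g where "g i = val (take i w1)" for i
    define h where "h i = val (take i w2)" for i
    define d where "d i = inv (g i) \<otimes> h i" for i
    have gc: "g i \<in> carrier G" and hc: "h i \<in> carrier G" for i
      using tA val_closed by (simp_all add: g_def h_def)
    have dD: "d i \<in> D" for i using ft[OF w] by (simp add: d_def g_def h_def)
    then have dc: "d i \<in> carrier G" for i using D by auto
    have gd: "g i \<otimes> d i = h i" for i using gc hc by (simp add: d_def m_assoc[symmetric])
    define \<Delta> where "\<Delta> i = wt (take i w1) + F (g i) (d i) - wt (take i w2)" for i
    have step: "\<bar>\<Delta> (Suc i) - \<Delta> i\<bar> \<le> 2 * B" for i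
    proof -
      obtain s where s: "s \<in> insert \<one> (\<mu> ` A)" "g (Suc i) = g i \<otimes> s"
          "wt (take (Suc i) w1) = wt (take i w1) + F (g i) s"
        using prefix_step[OF wA(1), of i] unfolding g_def by metis
      obtain s' where s': "s' \<in> insert \<one> (\<mu> ` A)" "h (Suc i) = h i \<otimes> s'"
          "wt (take (Suc i) w2) = wt (take i w2) + F (h i) s'"
        using prefix_step[OF wA(2), of i] unfolding h_def by metis
      have sc: "s \<in> carrier G" "s' \<in> carrier G" using s s' S by auto
      have "g i \<otimes> (s \<otimes> d (Suc i)) = g i \<otimes> (d i \<otimes> s')"
        using gd[of "Suc i"] gd[of i] sc gc dc by (simp add: s(2) s'(2) m_assoc[symmetric])
      \<comment> \<open>Both ways around a square end at the same point; this common diagonal is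
        what the two triangles share.\<close>
      then have sq: "s \<otimes> d (Suc i) = d i \<otimes> s'" using sc gc dc by simp
      have "\<bar>F (g i) s + F (g (Suc i)) (d (Suc i)) - F (g i) (s \<otimes> d (Suc i))\<bar> \<le> B"
        unfolding s(2) by (rule B) (use gc dD s in auto)
      moreover have "\<bar>F (g i) (d i) + F (h i) s' - F (g i) (s \<otimes> d (Suc i))\<bar> \<le> B"
        unfolding sq gd[symmetric] by (rule B) (use gc dD s' in auto)
      ultimately show ?thesis unfolding \<Delta>_def s(3) s'(3) by linarith
    qed
    have bound: "\<bar>\<Delta> i\<bar> \<le> 2 * B * real i" for i
    proof (induction i)
      case 0
      then show ?case using F_one[OF one_closed] by (simp add: \<Delta>_def d_def g_def h_def)
    next
      case (Suc i)
      then show ?case using step[of i] by (simp add: algebra_simps)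
    qed
    \<comment> \<open>Any index beyond both lengths works, since the prefixes are then the full
      words.\<close>
    define n where "n = length w1 + length w2"
    have n: "take n w1 = w1" "take n w2 = w2" by (simp_all add: n_def)
    have "val w1 \<otimes> ext x = val w2" using w by (simp add: pair_lang_iff[OF x])
    then have "d n = ext x"
      using gc[of n] hc[of n] ext_closed[OF x] by (simp add: d_def g_def h_def n inv_solve_left')
    then show "\<bar>wt w1 + F (val w1) (ext x) - wt w2\<bar> \<le> 2 * B * (real (length w1) + real (length w2))"
      using bound[of n] by (simp add: \<Delta>_def n g_def) (simp add: n_def)
  qed
qed

text \<open>Cutting an accepted pair just past the end of \<open>w\<close> and completing it by a
  tail of bounded length keeps \<open>w\<close> and shortens its partner.\<close>

lemma short_neighbour:
  assumes x: "x \<in> insert None (Some ` A)"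
  obtains c :: nat where "\<And>w. w \<in> L \<Longrightarrow> \<exists>w'. (w, w') \<in> pair_lang A (M x) \<and> length w' \<le> length w + c"
proof -
  obtain C where C: "finite C" "C \<subseteq> lists A \<times> lists A"
    and complete: "\<And>w1 w2 i. (w1, w2) \<in> pair_lang A (M x) \<Longrightarrow>
       \<exists>(v1, v2) \<in> C. (take i w1 @ v1, take i w2 @ v2) \<in> pair_lang A (M x) \<and> (length w1 < i \<longrightarrow> v1 = [])"
    by (rule pair_lang_completion[OF dfa[OF x]], rule that)
  define c where "c = (\<Sum>v\<in>C. length (snd v))"
  show ?thesis
  proof (rule that[of "Suc c"])
    fix w assume w: "w \<in> L"
    then have "val w \<otimes> ext x \<in> carrier G" using L_lists val_closed ext_closed[OF x] by auto
    then obtain w2 where "w2 \<in> L" "val w2 = val w \<otimes> ext x" using onto by (metis imageE)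
    then have "(w, w2) \<in> pair_lang A (M x)" using w by (simp add: pair_lang_iff[OF x])
    \<comment> \<open>The cut is one letter past the end of \<open>w\<close>, which forces the tail
      of \<open>w\<close> to be empty and accounts for the \<open>Suc\<close> in the
      constant.\<close>
    from complete[OF this, of "Suc (length w)"] obtain v2 where
      v: "([], v2) \<in> C" "(w, take (Suc (length w)) w2 @ v2) \<in> pair_lang A (M x)"
      by auto
    have "length v2 \<le> c"
      using member_le_sum[OF v(1), of "\<lambda>v. length (snd v)"] C(1) by (simp add: c_def)
    then show "\<exists>w'. (w, w') \<in> pair_lang A (M x) \<and> length w' \<le> length w + Suc c"
      using v(2) by (intro exI[of _ "take (Suc (length w)) w2 @ v2"]) auto
  qed
qed

section \<open>Tracing paths by accepted words\<close>

text \<open>This form is closed under products: bounded growth of length keeps the error of a second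
  factor linear. The summand 1 absorbs constant errors even when \<open>w\<close> is empty.\<close>

definition traceable :: "'a \<Rightarrow> nat \<Rightarrow> real \<Rightarrow> bool" where
  "traceable y c K \<longleftrightarrow> K \<ge> 0 \<and> (\<forall>w\<in>L. \<exists>w'\<in>L. val w' = val w \<otimes> y \<and> length w' \<le> length w + c
     \<and> \<bar>wt w + F (val w) y - wt w'\<bar> \<le> K * (real (length w) + 1))"

lemma traceable_letter:
  assumes "a \<in> A"
  shows "\<exists>c K. traceable (\<mu> a) c K"
proof -
  have x: "Some a \<in> insert None (Some ` A)" using assms by simp
  obtain c where c: "\<And>w. w \<in> L \<Longrightarrow> \<exists>w'. (w, w') \<in> pair_lang A (M (Some a)) \<and> length w' \<le> length w + c"
    by (rule short_neighbour[OF x], rule that)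
  obtain K where K: "K \<ge> 0" "\<And>w1 w2. (w1, w2) \<in> pair_lang A (M (Some a)) \<Longrightarrow>
      \<bar>wt w1 + F (val w1) (ext (Some a)) - wt w2\<bar> \<le> K * (real (length w1) + real (length w2))"
    by (rule strip[OF x], rule that)
  have "traceable (\<mu> a) c (K * (2 + real c))"
    unfolding traceable_def
  proof (intro conjI ballI)
    show "0 \<le> K * (2 + real c)" using K(1) by simp
    fix w assume "w \<in> L"
    then obtain w' where w': "(w, w') \<in> pair_lang A (M (Some a))" "length w' \<le> length w + c"
      using c by blast
    have "real (length w) + real (length w') \<le> 2 * real (length w) + real c" using w'(2) by linarith
    also have "\<dots> \<le> (2 + real c) * (real (length w) + 1)" by (simp add: algebra_simps)
    finally have "K * (real (length w) + real (length w')) \<le> K * ((2 + real c) * (real (length w) + 1))"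
      by (rule mult_left_mono[OF _ K(1)])
    then have "\<bar>wt w + F (val w) (\<mu> a) - wt w'\<bar> \<le> K * (2 + real c) * (real (length w) + 1)"
      using K(2)[OF w'(1)] by (simp add: ext_def mult.assoc)
    then show "\<exists>w'\<in>L. val w' = val w \<otimes> \<mu> a \<and> length w' \<le> length w + c
        \<and> \<bar>wt w + F (val w) (\<mu> a) - wt w'\<bar> \<le> K * (2 + real c) * (real (length w) + 1)"
      using w' by (auto simp: pair_lang_iff[OF x] ext_def)
  qed
  then show ?thesis by blast
qed

text \<open>The errors of the two moves add up, together with the defect of the triangle with sides
  \<open>y\<close>, \<open>y'\<close> and their product.\<close>

lemma traceable_mult:
  assumes y: "y \<in> carrier G" "traceable y c K" and y': "y' \<in> carrier G" "traceable y' c' K'"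
  shows "\<exists>c K. traceable (y \<otimes> y') c K"
proof -
  obtain B where B: "\<And>g s s'. g \<in> carrier G \<Longrightarrow> s \<in> {y, y'} \<Longrightarrow> s' \<in> {y, y'} \<Longrightarrow>
      \<bar>F g s + F (g \<otimes> s) s' - F g (s \<otimes> s')\<bar> \<le> B"
    using defect[of "{y, y'}"] y y' by (metis finite.simps insert_subset empty_subsetI)
  have "\<bar>F \<one> y + F (\<one> \<otimes> y) y - F \<one> (y \<otimes> y)\<bar> \<le> B" by (rule B) auto
  then have B0: "B \<ge> 0" by linarith
  have K: "K \<ge> 0" "K' \<ge> 0" using y(2) y'(2) by (simp_all add: traceable_def)
  have "traceable (y \<otimes> y') (c + c') (K + K' * (real c + 1) + B)"
    unfolding traceable_def
  proof (intro conjI ballI)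
    show "0 \<le> K + K' * (real c + 1) + B" using K B0 by simp
    fix w assume w: "w \<in> L"
    obtain w1 where w1: "w1 \<in> L" "val w1 = val w \<otimes> y" "length w1 \<le> length w + c"
        "\<bar>wt w + F (val w) y - wt w1\<bar> \<le> K * (real (length w) + 1)"
      using y(2) w unfolding traceable_def by blast
    obtain w2 where w2: "w2 \<in> L" "val w2 = val w1 \<otimes> y'" "length w2 \<le> length w1 + c'"
        "\<bar>wt w1 + F (val w1) y' - wt w2\<bar> \<le> K' * (real (length w1) + 1)"
      using y'(2) w1(1) unfolding traceable_def by blast
    have g: "val w \<in> carrier G" using w L_lists val_closed by auto
    have "real (length w1) + 1 \<le> real (length w) + real c + 1" using w1(3) by linarith
    also have "\<dots> \<le> (real c + 1) * (real (length w) + 1)" by (simp add: algebra_simps)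
    finally have "K' * (real (length w1) + 1) \<le> K' * ((real c + 1) * (real (length w) + 1))"
      by (rule mult_left_mono[OF _ K(2)])
    moreover have "\<bar>F (val w) y + F (val w1) y' - F (val w) (y \<otimes> y')\<bar> \<le> B"
      unfolding w1(2) by (rule B) (use g in auto)
    moreover have "B \<le> B * (real (length w) + 1)" using B0 by (simp add: algebra_simps)
    ultimately have "\<bar>wt w + F (val w) (y \<otimes> y') - wt w2\<bar>
        \<le> K * (real (length w) + 1) + K' * ((real c + 1) * (real (length w) + 1)) + B * (real (length w) + 1)"
      using w1(4) w2(4) by linarith
    also have "\<dots> = (K + K' * (real c + 1) + B) * (real (length w) + 1)"
      by (simp add: algebra_simps)
    finally show "\<exists>w'\<in>L. val w' = val w \<otimes> (y \<otimes> y') \<and> length w' \<le> length w + (c + c')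
        \<and> \<bar>wt w + F (val w) (y \<otimes> y') - wt w'\<bar> \<le> (K + K' * (real c + 1) + B) * (real (length w) + 1)"
      using w1 w2 g y y' by (intro bexI[of _ w2]) (auto simp: m_assoc)
  qed
  then show ?thesis by blast
qed

text \<open>Every element is a product of letters, as \<open>A\<close> generates the group as a
  semigroup.\<close>

lemma traceable_all:
  assumes "y \<in> carrier G"
  shows "\<exists>c K. traceable y c K"
proof -
  have "\<exists>c K. traceable (val u) c K" if "u \<in> lists A" for u
    using that
  proof (induction u)
    case Nil
    have "traceable (val []) 0 0"
      unfolding traceable_def using L_lists val_closed by (auto simp: F_one)
    then show ?case by blast
  next
    case (Cons a u)
    then show ?case using traceable_letter[of a] traceable_mult[of "\<mu> a" _ _ "val u"] muD val_closed
      by auto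
  qed
  then show ?thesis using assms gen by (metis DiffD1 imageE)
qed

text \<open>Representatives grow by at most \<open>c\<close> per step, so each step costs an error
  linear in the total length, and the number of steps supplies the second factor.\<close>

lemma trace_path:
  assumes c: "\<And>y. y \<in> X \<Longrightarrow> traceable y c K" and K: "K \<ge> 0" and X: "X \<subseteq> carrier G"
    and xs: "xs \<in> lists X" and w: "w \<in> L"
  shows "\<exists>w'\<in>L. val w' = val w \<otimes> word_val G id xs \<and> length w' \<le> length w + c * length xs
    \<and> \<bar>wt w + path_sum G F (val w) xs - wt w'\<bar>
      \<le> K * real (length xs) * (real (length w) + real c * real (length xs) + 1)"
  using xs w
proof (induction xs arbitrary: w)
  case Nil
  then show ?case using L_lists val_closed by (intro bexI[of _ w]) auto
next
  case (Cons y xs)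
  have "set (y # xs) \<subseteq> carrier G" using Cons.hyps Cons.prems X by auto
  then have y: "y \<in> carrier G" "word_val G id xs \<in> carrier G" "val w \<in> carrier G"
    using Cons.prems L_lists val_closed by (auto intro!: word_val_closed)
  define n where "n = real (length xs)"
  define l where "l = real (length w)"
  obtain w1 where w1: "w1 \<in> L" "val w1 = val w \<otimes> y" "length w1 \<le> length w + c"
      "\<bar>wt w + F (val w) y - wt w1\<bar> \<le> K * (l + 1)"
    using c[OF Cons.hyps(1)] Cons.prems unfolding traceable_def l_def by blast
  obtain w2 where w2: "w2 \<in> L" "val w2 = val w1 \<otimes> word_val G id xs" "length w2 \<le> length w1 + c * length xs"
      "\<bar>wt w1 + path_sum G F (val w1) xs - wt w2\<bar> \<le> K * n * (real (length w1) + real c * n + 1)"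
    using Cons.IH[OF w1(1)] unfolding n_def by blast
  have n: "n \<ge> 0" "l \<ge> 0" by (simp_all add: n_def l_def)
  have "real (length w1) \<le> l + real c" using w1(3) by (simp add: l_def)
  then have "K * n * (real (length w1) + real c * n + 1) \<le> K * n * (l + real c + real c * n + 1)"
    using K n by (intro mult_left_mono) auto
  moreover have "K * (l + 1) \<le> K * (l + real c + real c * n + 1)"
    using K n by (intro mult_left_mono) auto
  moreover have "\<bar>wt w + (F (val w) y + path_sum G F (val w1) xs) - wt w2\<bar>
      \<le> K * (l + 1) + K * n * (real (length w1) + real c * n + 1)"
    using w1(4) w2(4) by linarith
  ultimately have "\<bar>wt w + path_sum G F (val w) (y # xs) - wt w2\<bar>
      \<le> K * (l + real c + real c * n + 1) + K * n * (l + real c + real c * n + 1)"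
    by (simp add: w1(2))
  also have "\<dots> = K * (n + 1) * (l + real c * (n + 1) + 1)" by (simp add: algebra_simps)
  finally have "\<bar>wt w + path_sum G F (val w) (y # xs) - wt w2\<bar>
      \<le> K * real (length (y # xs)) * (real (length w) + real c * real (length (y # xs)) + 1)"
    by (simp add: n_def l_def add.commute)
  moreover have "length w2 \<le> length w + c * length (y # xs)" using w1(3) w2(3) by simp
  moreover have "val w2 = val w \<otimes> word_val G id (y # xs)" using w1(2) w2(2) y by (simp add: m_assoc)
  ultimately show ?case using w2(1) by blast
qed

text \<open>Tracing the loop from a representative \<open>w0\<close> of the identity ends at a
  representative \<open>w\<close> of the identity. The equality automaton compares the two, at a
  cost linear in their lengths.\<close>

theorem loop_bound:
  assumes fin: "finite X" and X: "X \<subseteq> carrier G"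
  obtains K where "\<And>xs. xs \<in> lists X \<Longrightarrow> word_val G id xs = \<one> \<Longrightarrow>
    \<bar>path_sum G F \<one> xs\<bar> \<le> K * (real (length xs) + 1)\<^sup>2"
proof -
  have "\<forall>y\<in>X. \<exists>cK. traceable y (fst cK) (snd cK)" using traceable_all X by auto
  then obtain f where f: "\<And>y. y \<in> X \<Longrightarrow> traceable y (fst (f y)) (snd (f y))"
    by (metis bchoice)
  \<comment> \<open>The sums serve as common upper bounds for the finitely many constants.\<close>
  define c where "c = (\<Sum>y\<in>X. fst (f y))"
  define K where "K = (\<Sum>y\<in>X. snd (f y))"
  have nn: "snd (f y) \<ge> 0" if "y \<in> X" for y using f[OF that] by (simp add: traceable_def)
  have K: "K \<ge> 0" unfolding K_def by (rule sum_nonneg) (use nn in auto)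
  have tr: "traceable y c K" if y: "y \<in> X" for y
  proof -
    have "fst (f y) \<le> c" unfolding c_def by (rule member_le_sum) (use y fin in auto)
    moreover have "snd (f y) \<le> K" unfolding K_def by (rule member_le_sum) (use y fin nn in auto)
    then have "snd (f y) * (real n + 1) \<le> K * (real n + 1)" for n by (intro mult_right_mono) auto
    ultimately show ?thesis using f[OF y] K unfolding traceable_def
      by (meson add_left_mono order_trans)
  qed
  obtain w0 where w0: "w0 \<in> L" "val w0 = \<one>" using onto by (metis imageE one_closed)
  have x: "None \<in> insert None (Some ` A)" by simp
  obtain K0 where K0: "K0 \<ge> 0" "\<And>w1 w2. (w1, w2) \<in> pair_lang A (M None) \<Longrightarrow>
      \<bar>wt w1 + F (val w1) (ext None) - wt w2\<bar> \<le> K0 * (real (length w1) + real (length w2))"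
    by (rule strip[OF x], rule that)
  define l where "l = real (length w0)"
  show ?thesis
  proof (rule that[of "K * (l + real c + 1) + K0 * (2 * l + real c)"])
    fix xs assume xs: "xs \<in> lists X" and loop: "word_val G id xs = \<one>"
    define n where "n = real (length xs)"
    obtain w where w: "w \<in> L" "val w = \<one>" "length w \<le> length w0 + c * length xs"
      and e: "\<bar>wt w0 + path_sum G F \<one> xs - wt w\<bar> \<le> K * n * (l + real c * n + 1)"
      using trace_path[OF tr K X xs w0(1)] unfolding w0(2) loop n_def l_def by auto
    have "(w0, w) \<in> pair_lang A (M None)" using w w0 by (simp add: pair_lang_iff[OF x] ext_def)
    from K0(2)[OF this] have e0: "\<bar>wt w0 - wt w\<bar> \<le> K0 * (l + real (length w))"
      by (simp add: ext_def w0(2) F_one l_def)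
    have "real (length w) \<le> real (length w0 + c * length xs)" using w(3) by (simp only: of_nat_le_iff)
    then have lw: "real (length w) \<le> l + real c * n" by (simp add: l_def n_def)
    have n: "n \<ge> 0" "l \<ge> 0" by (simp_all add: n_def l_def)
    have sq: "(n + 1)\<^sup>2 = n * n + 2 * n + 1" by (simp add: power2_eq_square algebra_simps)
    have "n * (l + real c * n + 1) \<le> (l + real c + 1) * (n + 1)\<^sup>2"
    proof -
      have "l * n + real c * n * n + n \<le> l * (n + 1)\<^sup>2 + real c * (n + 1)\<^sup>2 + (n + 1)\<^sup>2"
        unfolding sq using n by (simp add: algebra_simps)
      then show ?thesis by (simp add: algebra_simps)
    qed
    then have a: "K * n * (l + real c * n + 1) \<le> K * (l + real c + 1) * (n + 1)\<^sup>2"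
      using mult_left_mono[OF _ K] by (simp only: mult.assoc)
    have "l + real (length w) \<le> 2 * l + real c * n" using lw by simp
    also have "\<dots> \<le> (2 * l + real c) * (n + 1)\<^sup>2"
    proof -
      have "2 * l * 1 \<le> 2 * l * (n + 1)\<^sup>2" "real c * n \<le> real c * (n + 1)\<^sup>2"
        using n by (intro mult_left_mono; simp add: sq)+
      then show ?thesis by (simp add: algebra_simps)
    qed
    finally have b: "K0 * (l + real (length w)) \<le> K0 * (2 * l + real c) * (n + 1)\<^sup>2"
      using mult_left_mono[OF _ K0(1)] by (simp only: mult.assoc)
    have "\<bar>path_sum G F \<one> xs\<bar> \<le> K * (l + real c + 1) * (n + 1)\<^sup>2 + K0 * (2 * l + real c) * (n + 1)\<^sup>2"
      using e e0 a b by linarith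
    then show "\<bar>path_sum G F \<one> xs\<bar> \<le> (K * (l + real c + 1) + K0 * (2 * l + real c)) * (real (length xs) + 1)\<^sup>2"
      by (simp add: n_def algebra_simps)
  qed
qed

end

text \<open>Homomorphisms map triangles to triangles and finite sets to finite sets. The weight is
  pulled back to \<open>Gm 1\<close> itself, instead of passing automaticity to its retract.\<close>

lemma edge_weight_pullback:
  assumes h: "group_hom G H h" and F: "edge_weight H F"
  shows "edge_weight G (\<lambda>g s. F (h g) (h s))"
proof -
  interpret h: group_hom G H h by fact
  interpret F: edge_weight H F by fact
  show ?thesis
  proof
    show "F (h g) (h \<one>\<^bsub>G\<^esub>) = 0" if "g \<in> carrier G" for g
      using that by (simp add: F.F_one)
    fix S assume S: "finite S" "S \<subseteq> carrier G"
    then have "finite (h ` S)" "h ` S \<subseteq> carrier H" by auto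
    then obtain B where B: "\<forall>g\<in>carrier H. \<forall>s\<in>h ` S. \<forall>s'\<in>h ` S.
        \<bar>F g s + F (g \<otimes>\<^bsub>H\<^esub> s) s' - F g (s \<otimes>\<^bsub>H\<^esub> s')\<bar> \<le> B"
      using F.defect by blast
    have "\<bar>F (h g) (h s) + F (h (g \<otimes>\<^bsub>G\<^esub> s)) (h s') - F (h g) (h (s \<otimes>\<^bsub>G\<^esub> s'))\<bar> \<le> B"
      if "g \<in> carrier G" "s \<in> S" "s' \<in> S" for g s s'
      using B[rule_format, of "h g" "h s" "h s'"] that S(2) by (simp add: subset_iff)
    then show "\<exists>B. \<forall>g\<in>carrier G. \<forall>s\<in>S. \<forall>s'\<in>S.
        \<bar>F (h g) (h s) + F (h (g \<otimes>\<^bsub>G\<^esub> s)) (h s') - F (h g) (h (s \<otimes>\<^bsub>G\<^esub> s'))\<bar> \<le> B"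
      by blast
  qed
qed

lemma (in group_hom) path_sum_pullback:
  assumes "g \<in> carrier G" "set xs \<subseteq> carrier G"
  shows "path_sum G (\<lambda>g s. F (h g) (h s)) g xs = path_sum H F (h g) (map h xs)"
  using assms by (induction xs arbitrary: g) auto

section \<open>\<open>G\<^sub>1\<close> is not automatic\<close>

text \<open>This is the ring Z[1/2].\<close>

definition dyadic :: "real set" where
  "dyadic = {x. \<exists>n::nat. x * 2 ^ n \<in> \<int>}"

lemma dyadic_mono:
  assumes "x * 2 ^ n \<in> \<int>" "n \<le> m"
  shows "x * 2 ^ m \<in> (\<int> :: real set)"
proof -
  obtain j where "m = n + j" using assms(2) by (auto simp: le_iff_add)
  then have "x * 2 ^ m = (x * 2 ^ n) * 2 ^ j" by (simp add: power_add)
  also have "\<dots> \<in> \<int>" using assms(1) by (rule Ints_mult) simp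
  finally show ?thesis .
qed

lemma dyadic_0 [simp]: "0 \<in> dyadic" by (simp add: dyadic_def)

lemma dyadic_1 [simp]: "1 \<in> dyadic" by (auto simp: dyadic_def intro: exI[of _ 0])

lemma dyadic_half: "1 / 2 \<in> dyadic" by (auto simp: dyadic_def intro: exI[of _ 1])

lemma dyadic_uminus: "x \<in> dyadic \<Longrightarrow> - x \<in> dyadic"
  by (auto simp: dyadic_def)

lemma dyadic_add:
  assumes "x \<in> dyadic" "y \<in> dyadic"
  shows "x + y \<in> dyadic"
proof -
  obtain n m where "x * 2 ^ n \<in> \<int>" "y * 2 ^ m \<in> \<int>" using assms by (auto simp: dyadic_def)
  then have "x * 2 ^ (n + m) \<in> \<int>" "y * 2 ^ (n + m) \<in> \<int>" by (auto elim: dyadic_mono)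
  then have "(x + y) * 2 ^ (n + m) \<in> \<int>" by (simp add: distrib_right)
  then show ?thesis by (auto simp: dyadic_def)
qed

lemma dyadic_powi:
  assumes "x \<in> dyadic"
  shows "2 powi k * x \<in> dyadic"
proof -
  obtain n where n: "x * 2 ^ n \<in> \<int>" using assms by (auto simp: dyadic_def)
  have "2 powi k * x * 2 ^ (n + nat (- k)) = x * 2 ^ n * 2 ^ nat k"
    by (cases "k \<ge> 0") (simp_all add: power_int_def power_add field_simps)
  also have "\<dots> \<in> \<int>" using n by simp
  finally show ?thesis unfolding dyadic_def by blast
qed

text \<open>This is \<open>BS(1, 2)\<close>, with \<open>c = (1, 0)\<close> and \<open>t = (0, 1)\<close>.\<close>

definition affine :: "(real \<times> int) monoid" where
  "affine = \<lparr>carrier = dyadic \<times> UNIV,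
     mult = (\<lambda>(x, k) (y, l). (x + 2 powi (- k) * y, k + l)), one = (0, 0)\<rparr>"

lemma affine_simps [simp]:
  "(x, k) \<in> carrier affine \<longleftrightarrow> x \<in> dyadic"
  "(x, k) \<otimes>\<^bsub>affine\<^esub> (y, l) = (x + 2 powi (- k) * y, k + l)"
  "\<one>\<^bsub>affine\<^esub> = (0, 0)"
  by (simp_all add: affine_def)

lemma group_affine: "group affine"
proof (rule groupI)
  show "x \<otimes>\<^bsub>affine\<^esub> y \<in> carrier affine" if "x \<in> carrier affine" "y \<in> carrier affine" for x y
    using that by (cases x; cases y) (simp add: dyadic_add dyadic_powi)
  show "x \<otimes>\<^bsub>affine\<^esub> y \<otimes>\<^bsub>affine\<^esub> z = x \<otimes>\<^bsub>affine\<^esub> (y \<otimes>\<^bsub>affine\<^esub> z)" for x y z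
    by (cases x; cases y; cases z) (simp add: algebra_simps power_int_diff power_int_minus divide_inverse)
  show "\<exists>y\<in>carrier affine. y \<otimes>\<^bsub>affine\<^esub> x = \<one>\<^bsub>affine\<^esub>" if "x \<in> carrier affine" for x
  proof -
    obtain u k where x: "x = (u, k)" by (cases x)
    then have "(- (2 powi k * u), - k) \<in> carrier affine"
      using that by (simp add: dyadic_powi dyadic_uminus)
    then show ?thesis by (rule rev_bexI) (simp add: x)
  qed
qed (auto simp: affine_def)

text \<open>The \<open>1\<close>-form \<open>dx\<close>, restricted to the part of the Cayley graph where \<open>x\<close> is an integer and
  \<open>k \<le> 0\<close>: this is one of the half-planes branching off at height \<open>0\<close>.\<close>

definition sheet_weight :: "real \<times> int \<Rightarrow> real \<times> int \<Rightarrow> real" where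
  "sheet_weight = (\<lambda>(x, k) (y, l). if x \<in> \<int> \<and> k \<le> 0 then 2 powi (- k) * y else 0)"

lemma sheet_weight_simp [simp]:
  "sheet_weight (x, k) (y, l) = (if x \<in> \<int> \<and> k \<le> 0 then 2 powi (- k) * y else 0)"
  by (simp add: sheet_weight_def)

text \<open>The defect is nonzero only if exactly one of \<open>g\<close> and \<open>g s\<close>
  lies in the sheet. Far below height 0 a bounded step cannot leave the sheet, far above both points
  are outside, and at the heights between the last edge has bounded weight.\<close>

lemma edge_weight_affine: "edge_weight affine sheet_weight"
proof -
  interpret group affine by (rule group_affine)
  show ?thesis
  proof
    show "sheet_weight g \<one>\<^bsub>affine\<^esub> = 0" for g by (cases g) simp
    fix S :: "(real \<times> int) set"
    assume S: "finite S" "S \<subseteq> carrier affine"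
    \<comment> \<open>A single \<open>N\<close> has to bound heights, coordinates and denominators
      on all of \<open>S\<close>.\<close>
    have "eventually (\<lambda>N. \<bar>snd s\<bar> \<le> int N \<and> \<bar>fst s\<bar> \<le> real N \<and> fst s * 2 ^ N \<in> \<int>) sequentially"
      if s: "s \<in> S" for s
    proof -
      have "s \<in> carrier affine" using S(2) s by blast
      then obtain n where n: "fst s * 2 ^ n \<in> \<int>" by (cases s) (auto simp: dyadic_def)
      have "\<bar>snd s\<bar> \<le> int N \<and> \<bar>fst s\<bar> \<le> real N \<and> fst s * 2 ^ N \<in> \<int>"
        if N: "N \<ge> max n (max (nat \<bar>snd s\<bar>) (nat \<lceil>\<bar>fst s\<bar>\<rceil>))" for N
      proof (intro conjI)
        show "fst s * 2 ^ N \<in> \<int>" using n by (rule dyadic_mono) (use N in simp)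
        show "\<bar>snd s\<bar> \<le> int N" using N by linarith
        have "\<bar>fst s\<bar> \<le> real (nat \<lceil>\<bar>fst s\<bar>\<rceil>)" by (rule real_nat_ceiling_ge)
        then show "\<bar>fst s\<bar> \<le> real N" using N by linarith
      qed
      then show ?thesis unfolding eventually_sequentially by blast
    qed
    then have "eventually (\<lambda>N. \<forall>s\<in>S. \<bar>snd s\<bar> \<le> int N \<and> \<bar>fst s\<bar> \<le> real N \<and> fst s * 2 ^ N \<in> \<int>) sequentially"
      using S(1) by (intro eventually_ball_finite) auto
    then obtain N where N: "\<And>s. s \<in> S \<Longrightarrow> \<bar>snd s\<bar> \<le> int N \<and> \<bar>fst s\<bar> \<le> real N \<and> fst s * 2 ^ N \<in> \<int>"
      by (auto simp: eventually_sequentially)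
    have "\<bar>sheet_weight g s + sheet_weight (g \<otimes>\<^bsub>affine\<^esub> s) s' - sheet_weight g (s \<otimes>\<^bsub>affine\<^esub> s')\<bar>
        \<le> 2 ^ (3 * N) * real N" if s: "s \<in> S" "s' \<in> S" for g s s'
    proof -
      obtain x k where g: "g = (x, k)" by (cases g)
      obtain y l where y: "s = (y, l)" by (cases s)
      obtain y' l' where y': "s' = (y', l')" by (cases s')
      define P where "P \<longleftrightarrow> x \<in> \<int> \<and> k \<le> 0"
      define Q where "Q \<longleftrightarrow> x + 2 powi (- k) * y \<in> \<int> \<and> k + l \<le> 0"
      define d where "d = 2 powi (- (k + l)) * y'"
      have bounds: "\<bar>l\<bar> \<le> int N" "\<bar>y'\<bar> \<le> real N" "y * 2 ^ N \<in> \<int>"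
        using N[OF s(1)] N[OF s(2)] by (simp_all add: y y')
      have "2 powi (- k) * (y + 2 powi (- l) * y') = 2 powi (- k) * y + d"
        by (simp add: d_def algebra_simps power_int_diff power_int_minus divide_inverse)
      then have eq: "sheet_weight g s + sheet_weight (g \<otimes>\<^bsub>affine\<^esub> s) s' - sheet_weight g (s \<otimes>\<^bsub>affine\<^esub> s')
          = (if Q then d else 0) - (if P then d else 0)"
        unfolding g y y' affine_simps sheet_weight_simp P_def[symmetric] Q_def[symmetric] d_def[symmetric]
        by simp
      consider "k \<le> - 2 * int N" | "k > int N" | "- 2 * int N < k" "k \<le> int N" by linarith
      then show ?thesis
      proof cases
        case 1
        then have "nat (- k) \<ge> N" "k \<le> 0" by linarith+
        then have "2 powi (- k) * y = y * 2 ^ nat (- k)" by (simp add: power_int_def)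
        also have "\<dots> \<in> \<int>" using bounds(3) \<open>nat (- k) \<ge> N\<close> by (rule dyadic_mono)
        finally have z: "2 powi (- k) * y \<in> \<int>" .
        have "x + 2 powi (- k) * y \<in> \<int> \<longleftrightarrow> x \<in> \<int>"
          by (metis z Ints_add Ints_diff add_diff_cancel_right')
        moreover have "k \<le> 0" "k + l \<le> 0" using 1 bounds(1) by linarith+
        ultimately have "P = Q" by (simp add: P_def Q_def)
        then show ?thesis unfolding eq by simp
      next
        case 2
        then have "\<not> k \<le> 0" "\<not> k + l \<le> 0" using bounds(1) by linarith+
        then have "\<not> P" "\<not> Q" by (simp_all add: P_def Q_def)
        then show ?thesis unfolding eq by simp
      next
        case 3
        then have "- (k + l) \<le> int (3 * N)" using bounds(1) by linarith
        then have "2 powi (- (k + l)) \<le> (2 :: real) powi int (3 * N)"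
          by (intro power_int_increasing) auto
        then have "2 powi (- (k + l)) \<le> (2 :: real) ^ (3 * N)" by (simp only: power_int_of_nat)
        then have "\<bar>d\<bar> \<le> 2 ^ (3 * N) * real N"
          unfolding d_def abs_mult using bounds(2) by (intro mult_mono) auto
        then show ?thesis unfolding eq by auto
      qed
    qed
    then show "\<exists>B. \<forall>g\<in>carrier affine. \<forall>s\<in>S. \<forall>s'\<in>S. \<bar>sheet_weight g s
        + sheet_weight (g \<otimes>\<^bsub>affine\<^esub> s) s' - sheet_weight g (s \<otimes>\<^bsub>affine\<^esub> s')\<bar> \<le> B"
      by blast
  qed
qed

text \<open>Vertical edges do not move the first coordinate, so the form \<open>dx\<close> vanishes
  on them.\<close>

lemma path_sum_vertical:
  "path_sum affine sheet_weight (x, k) (replicate n (0, e) @ ys)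
   = path_sum affine sheet_weight (x, k + e * int n) ys"
  by (induction n arbitrary: k) (auto simp: algebra_simps)

text \<open>Spells \<open>[x\<^sup>-\<^sup>1, d\<^sup>-\<^sup>1]\<close> for \<open>x = t\<^sup>-\<^sup>n c t\<^sup>n\<close>; the primed letters stand for inverses. In \<open>BS(1, 2)\<close>
  it is trivial for \<open>d = t c t\<^sup>-\<^sup>1\<close>, because \<open>x\<close> is a power of \<open>c\<close> and \<open>c = d\<^sup>2\<close>.\<close>

definition bs_loop :: "nat \<Rightarrow> 'g \<Rightarrow> 'g \<Rightarrow> 'g \<Rightarrow> 'g \<Rightarrow> 'g \<Rightarrow> 'g \<Rightarrow> 'g list" where
  "bs_loop n t t' c c' d d' = replicate n t' @ c # replicate n t @ d # replicate n t' @ c' # replicate n t @ [d']"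

lemma map_bs_loop:
  "map f (bs_loop n t t' c c' d d') = bs_loop n (f t) (f t') (f c) (f c') (f d) (f d')"
  by (simp add: bs_loop_def)

lemma (in group) word_val_replicate:
  assumes "x \<in> carrier G"
  shows "word_val G id (replicate n x) = x [^] n"
  using assms by (induction n) (simp_all, metis nat_pow_Suc nat_pow_Suc2)

lemma (in group) bs_loop_trivial:
  assumes c: "c \<in> carrier G" and t: "t \<in> carrier G" and rel: "c \<otimes> t = t \<otimes> c [^] (2::int)"
  shows "word_val G id (bs_loop n t (inv t) c (inv c) (t \<otimes> c \<otimes> inv t) (inv (t \<otimes> c \<otimes> inv t))) = \<one>"
proof -
  define d where "d = t \<otimes> c \<otimes> inv t"
  have d: "d \<in> carrier G" using c t by (simp add: d_def)
  have dt: "d \<otimes> t = t \<otimes> c" using c t by (simp add: d_def m_assoc)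
  have "d [^] (2::int) \<otimes> t = c \<otimes> t"
    using int_pow_intertwine[OF d c t dt, of 2] rel by simp
  then have dc: "d [^] (2::int) = c" using c d t by simp
  have powc: "c [^] j \<otimes> t = t \<otimes> c [^] (2 * j)" for j :: int
    using int_pow_intertwine[OF c _ t rel, of j] c by (simp add: int_pow_pow)
  have "c \<otimes> t [^] n = t [^] n \<otimes> c [^] (2 ^ n :: int)"
  proof (induction n)
    case 0
    then show ?case using c by simp
  next
    case (Suc n)
    have "c \<otimes> t [^] Suc n = t [^] n \<otimes> (c [^] (2 ^ n :: int) \<otimes> t)"
      using Suc c t by (simp add: m_assoc[symmetric])
    also have "\<dots> = t [^] Suc n \<otimes> c [^] (2 ^ Suc n :: int)"
      unfolding powc using c t by (simp add: m_assoc)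
    finally show ?case .
  qed
  then have p: "inv (t [^] n) \<otimes> (c \<otimes> t [^] n) = c [^] (2 ^ n :: int)"
    using c t by (simp add: inv_solve_left')
  define p where "p = c [^] (2 ^ n :: int)"
  have pc: "p \<in> carrier G" using c by (simp add: p_def)
  \<comment> \<open>With a trailing factor \<open>z\<close>, the conjugate can be rewritten inside
    right-nested products.\<close>
  have p1: "inv (t [^] n) \<otimes> (c \<otimes> (t [^] n \<otimes> z)) = p \<otimes> z" if "z \<in> carrier G" for z
    using arg_cong[OF p, of "\<lambda>u. u \<otimes> z"] c t that by (simp add: m_assoc p_def)
  have "inv p = inv (t [^] n) \<otimes> (inv c \<otimes> t [^] n)"
    unfolding p_def p[symmetric] using c t by (simp add: inv_mult_group m_assoc)
  then have p2: "inv (t [^] n) \<otimes> (inv c \<otimes> (t [^] n \<otimes> z)) = inv p \<otimes> z" if "z \<in> carrier G" for z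
    using c t that by (simp add: m_assoc)
  have "p = d [^] (2 * 2 ^ n :: int)" using d by (simp add: p_def dc[symmetric] int_pow_pow)
  then have comm: "p \<otimes> d = d \<otimes> p" using pow_commute[OF d, of "2 * 2 ^ n" 1] d by simp
  have app: "word_val G id (replicate n x @ ys) = x [^] n \<otimes> word_val G id ys"
    if "x \<in> carrier G" "set ys \<subseteq> carrier G" for x ys
    using that word_val_append[of id "replicate n x" ys]
    by (simp add: word_val_replicate set_replicate_conv_if split: if_splits)
  have "word_val G id (bs_loop n t (inv t) c (inv c) d (inv d)) = p \<otimes> (d \<otimes> (inv p \<otimes> inv d))"
    using c d t pc by (simp add: bs_loop_def app word_val_closed nat_pow_inv set_replicate_conv_if p1 p2)
  also have "\<dots> = (p \<otimes> d) \<otimes> inv (d \<otimes> p)" using pc d by (simp add: inv_mult_group m_assoc)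
  also have "\<dots> = \<one>" unfolding comm using pc d by simp
  finally show ?thesis by (simp only: d_def)
qed

text \<open>The first \<open>c\<close>, at height \<open>- n\<close>, weighs \<open>2 ^ n\<close>,
  and \<open>d\<close> weighs 1/2. From there on the first coordinate is not an integer, so the way
  back lies on another sheet and weighs nothing.\<close>

lemma path_sum_bs_loop:
  "path_sum affine sheet_weight (0, 0) (bs_loop n (0, 1) (0, - 1) (1, 0) (- 1, 0) (1 / 2, 0) (- 1 / 2, 0))
   = 2 ^ n + 1 / 2"
proof -
  have "(1 / 2 :: real) \<notin> \<int>"
  proof
    assume "(1 / 2 :: real) \<in> \<int>"
    then obtain z where "(1 / 2 :: real) = of_int z" by (rule Ints_cases)
    then have "2 * z = 1" by linarith
    then show False by presburger
  qed
  moreover have "(2 ^ n + 1 / 2 :: real) \<in> \<int> \<longleftrightarrow> (1 / 2 :: real) \<in> \<int>"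
    by (metis Ints_add Ints_diff Ints_power Ints_numeral add_diff_cancel_left')
  ultimately show ?thesis
    by (simp add: bs_loop_def path_sum_vertical)
qed

theorem Gm_1_not_automatic: "\<not> automatic (Gm 1)"
proof
  let ?G = "Gm 1"
  interpret G: group ?G by (rule group_Gm)
  interpret aff: group affine by (rule group_affine)
  let ?a = "(1, 0) :: real \<times> int" and ?t = "(0, 1) :: real \<times> int"
  have a2: "?a [^]\<^bsub>affine\<^esub> (2::int) = (2, 0)"
    using aff.int_pow_mult[of ?a 1 1] by simp
  \<comment> \<open>For \<open>m = 1\<close> the power \<open>c^m\<close> is \<open>c\<close>, so
    \<open>a\<close> and its commutator with \<open>t\<close> have the same image.\<close>
  obtain h where h: "h \<in> hom ?G affine" "h (Gm_t 1) = ?t" "h (Gm_c 1) = ?a"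
    by (rule Gm_lift[OF group_affine, of ?a ?t ?a 1]) (simp_all add: a2 power_int_minus)
  interpret h: group_hom ?G affine h
    by (intro group_hom.intro group_hom_axioms.intro G.is_group group_affine h)
  let ?F = "\<lambda>g s. sheet_weight (h g) (h s)"
  interpret F: edge_weight ?G ?F
    by (rule edge_weight_pullback[OF h.group_hom_axioms edge_weight_affine])
  assume "automatic ?G"
  then obtain A :: "nat set" and \<mu> and W :: "(nat, nat) dfa"
    and M :: "nat option \<Rightarrow> (nat, nat option \<times> nat option) dfa"
    where "automatic_structure ?G A \<mu> W M"
    unfolding automatic_def by blast
  then interpret automatic_edge_weight ?G ?F A \<mu> W M
    by unfold_locales
  let ?c = "Gm_c 1" and ?t = "Gm_t 1"
  define d where "d = ?t \<otimes>\<^bsub>?G\<^esub> ?c \<otimes>\<^bsub>?G\<^esub> inv\<^bsub>?G\<^esub> ?t"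
  have d: "d \<in> carrier ?G" by (simp add: d_def)
  define X where "X = {?t, inv\<^bsub>?G\<^esub> ?t, ?c, inv\<^bsub>?G\<^esub> ?c, d, inv\<^bsub>?G\<^esub> d}"
  define xs where "xs n = bs_loop n ?t (inv\<^bsub>?G\<^esub> ?t) ?c (inv\<^bsub>?G\<^esub> ?c) d (inv\<^bsub>?G\<^esub> d)" for n
  have X: "X \<subseteq> carrier ?G" "finite X" using d by (auto simp: X_def)
  obtain K where K: "\<And>xs. xs \<in> lists X \<Longrightarrow> word_val ?G id xs = \<one>\<^bsub>?G\<^esub> \<Longrightarrow>
      \<bar>path_sum ?G ?F \<one>\<^bsub>?G\<^esub> xs\<bar> \<le> K * (real (length xs) + 1)\<^sup>2"
    by (rule loop_bound[OF X(2,1)], rule that)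
  have inv_aff: "inv\<^bsub>affine\<^esub> (0, 1) = (0, - 1)" "inv\<^bsub>affine\<^esub> (1, 0) = (- 1, 0)"
    "inv\<^bsub>affine\<^esub> (1 / 2, 0) = (- 1 / 2, 0)"
    by (rule aff.inv_equality; simp add: dyadic_half dyadic_uminus)+
  have hd: "h d = (1 / 2, 0)"
    by (simp add: d_def h inv_aff power_int_minus)
  have "2 ^ n + 1 / 2 \<le> K * (4 * real n + 5)\<^sup>2" for n
  proof -
    have xX: "xs n \<in> lists X" by (auto simp: xs_def bs_loop_def X_def)
    have "?c \<otimes>\<^bsub>?G\<^esub> ?t = ?t \<otimes>\<^bsub>?G\<^esub> ?c [^]\<^bsub>?G\<^esub> (2::int)" using Gm_relation[of 1] by simp
    then have "word_val ?G id (xs n) = \<one>\<^bsub>?G\<^esub>"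
      unfolding xs_def d_def by (rule G.bs_loop_trivial[rotated 2]) simp_all
    from K[OF xX this] have "\<bar>path_sum ?G ?F \<one>\<^bsub>?G\<^esub> (xs n)\<bar> \<le> K * (real (length (xs n)) + 1)\<^sup>2" .
    moreover have "real (length (xs n)) + 1 = 4 * real n + 5" by (simp add: xs_def bs_loop_def)
    moreover have "path_sum ?G ?F \<one>\<^bsub>?G\<^esub> (xs n) = path_sum affine sheet_weight (0, 0) (map h (xs n))"
      using xX X by (subst h.path_sum_pullback) auto
    moreover have "map h (xs n) = bs_loop n (0, 1) (0, - 1) (1, 0) (- 1, 0) (1 / 2, 0) (- 1 / 2, 0)"
      using d by (simp add: xs_def map_bs_loop h hd inv_aff)
    ultimately show ?thesis using path_sum_bs_loop[of n] by simp
  qed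
  note lower = this
  \<comment> \<open>Exponential weight outgrows the quadratic bound for loops of length
    \<open>4 n + 4\<close>.\<close>
  have "eventually (\<lambda>n. K * (4 * real n + 5)\<^sup>2 < 2 ^ n) sequentially"
    by real_asymp
  then obtain n where "K * (4 * real n + 5)\<^sup>2 < 2 ^ n"
    by (auto simp: eventually_sequentially)
  with lower[of n] show False by linarith
qed

theorem theorem1p3:
  shows "(\<forall>m::int. m \<ge> 1 \<longrightarrow> contains_as_retract (Gm m) (BS m (m + 1)))
    \<and> (\<not> hopfian (Gm 2) \<and> \<not> residually_finite (Gm 2))
    \<and> \<not> automatic (Gm 1)"
  using Gm_contains_BS_as_retract Gm_2_not_hopfian Gm_2_not_residually_finite Gm_1_not_automatic
  by blast

end
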